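(* For every separable metric structure $M$ (in a countable language, with at least two elements), the natural action of $\mathrm{Aut}(M)\wr\Omega$ on the Borel randomization $M^R$ identifies $\mathrm{Aut}(M)\wr\Omega$ with $\mathrm{Aut}(M^R)$ as topological groups; that is, $\mathrm{Aut}(M^R)=\mathrm{Aut}(M)\wr\Omega$.
   Context: Structures are in the sense of continuous first-order logic; automorphism groups carry the topology of pointwise convergence. $\Omega=[0,1]$ with Lebesgue measure $\mu$. The Borel randomization $M^R$ of $M$ (language $L$) is the two-sorted structure whose main sort is $M^\Omega=L^0(\Omega,M)$ (Borel maps modulo a.e. equality) with metric $d^\Omega(r,s)=\int d(r(\omega),s(\omega))\,d\mu$, and whose auxiliary sort is $\mathbb A=L^0(\Omega,[0,1])$ with metric $\mathbb E|R-S|$; it is equipped, for each $L$-formula $\varphi(x_1,\dots,x_n)$, with the function $[\![\varphi]\!]\colon(M^\Omega)^n\to\mathbb A$, $[\![\varphi(r)]\!](\omega)=\varphi(r(\omega))$, with the expectation predicate $\mathbb E\colon\mathbb A\to[0,1]$, $\mathbb ER=\int R\,d\mu$, and with functions for the pointwise continuous (arithmetic) operations on $\mathbb A$. $\mathrm{Aut}(\Omega)$ is the group of invertible measure-preserving transformations of $\Omega$ mod null sets; $G^\Omega$ the group of measurable maps $\Omega\to G$ mod null sets; $G\wr\Omega=G^\Omega\rtimes\mathrm{Aut}(\Omega)$ with $(t\cdot g)(\omega)=g(t^{-1}(\omega))$ and product topology (convergence in measure on $G^\Omega$). With $G=\mathrm{Aut}(M)$, $G\wr\Omega$ acts on $M^R$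 as follows: $g\in G^\Omega$ acts on $M^\Omega$ by $(gr)(\omega)=g(\omega)(r(\omega))$ and trivially on $\mathbb A$; $t\in\mathrm{Aut}(\Omega)$ acts on both sorts by $(tr)(\omega)=r(t^{-1}(\omega))$. *)

theory Defs
  imports "HOL-Probability.Probability"
begin

text \<open>A language: function symbols of type 'f and predicate symbols of type 'p
 (countable types), with arities. A metric structure has as universe the
 type 'm (a Polish, i.e. complete separable, metric space), with the type's metric.\<close>

record ('f, 'p, 'm) mstruct =
  fun_ar  :: "'f \<Rightarrow> nat"
  pred_ar :: "'p \<Rightarrow> nat"
  fun_int :: "'f \<Rightarrow> 'm list \<Rightarrow> 'm"
  pred_int :: "'p \<Rightarrow> 'm list \<Rightarrow> real"

definition ucont_list :: "nat \<Rightarrow> ('a::metric_space list \<Rightarrow> 'b::metric_space) \<Rightarrow> bool" where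
  "ucont_list n f \<longleftrightarrow> (\<forall>e>0. \<exists>d>0. \<forall>xs ys. length xs = n \<and> length ys = n \<and>
      (\<forall>i<n. dist (xs!i) (ys!i) < d) \<longrightarrow> dist (f xs) (f ys) < e)"

definition metric_structure :: "('f, 'p, 'm::metric_space) mstruct \<Rightarrow> bool" where
  "metric_structure M \<longleftrightarrow>
     (\<forall>x y::'m. dist x y \<le> 1) \<and>
     (\<forall>f. ucont_list (fun_ar M f) (fun_int M f)) \<and>
     (\<forall>p. ucont_list (pred_ar M p) (pred_int M p) \<and>
          (\<forall>xs. length xs = pred_ar M p \<longrightarrow> pred_int M p xs \<in> {0..1}))"

definition conn_ok :: "nat \<Rightarrow> (real list \<Rightarrow> real) \<Rightarrow> bool" where
  "conn_ok n c \<longleftrightarrow>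
     (\<forall>xs. length xs = n \<and> set xs \<subseteq> {0..1} \<longrightarrow> c xs \<in> {0..1}) \<and>
     (\<forall>e>0. \<exists>d>0. \<forall>xs ys. length xs = n \<and> length ys = n \<and> set xs \<subseteq> {0..1} \<and> set ys \<subseteq> {0..1} \<and>
        (\<forall>i<n. \<bar>xs!i - ys!i\<bar> < d) \<longrightarrow> \<bar>c xs - c ys\<bar> < e)"

datatype 'f trm = Var nat | Fn 'f "'f trm list"

datatype ('f, 'p) fml =
    Atom 'p "'f trm list"
  | Dst "'f trm" "'f trm"
  | Conn "real list \<Rightarrow> real" "('f, 'p) fml list"
  | Sup nat "('f, 'p) fml"
  | Inf nat "('f, 'p) fml"

fun wf_trm :: "('f, 'p, 'm) mstruct \<Rightarrow> 'f trm \<Rightarrow> bool" where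
  "wf_trm M (Var n) = True"
| "wf_trm M (Fn f ts) = (length ts = fun_ar M f \<and> (\<forall>t\<in>set ts. wf_trm M t))"

fun wf_fml :: "('f, 'p, 'm) mstruct \<Rightarrow> ('f, 'p) fml \<Rightarrow> bool" where
  "wf_fml M (Atom p ts) = (length ts = pred_ar M p \<and> (\<forall>t\<in>set ts. wf_trm M t))"
| "wf_fml M (Dst t u) = (wf_trm M t \<and> wf_trm M u)"
| "wf_fml M (Conn c fs) = (conn_ok (length fs) c \<and> (\<forall>f\<in>set fs. wf_fml M f))"
| "wf_fml M (Sup x f) = wf_fml M f"
| "wf_fml M (Inf x f) = wf_fml M f"

fun teval :: "('f, 'p, 'm) mstruct \<Rightarrow> (nat \<Rightarrow> 'm) \<Rightarrow> 'f trm \<Rightarrow> 'm" where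
  "teval M \<rho> (Var n) = \<rho> n"
| "teval M \<rho> (Fn f ts) = fun_int M f (map (teval M \<rho>) ts)"

fun feval :: "('f, 'p, 'm::metric_space) mstruct \<Rightarrow> (nat \<Rightarrow> 'm) \<Rightarrow> ('f, 'p) fml \<Rightarrow> real" where
  "feval M \<rho> (Atom p ts) = pred_int M p (map (teval M \<rho>) ts)"
| "feval M \<rho> (Dst t u) = dist (teval M \<rho> t) (teval M \<rho> u)"
| "feval M \<rho> (Conn c fs) = c (map (feval M \<rho>) fs)"
| "feval M \<rho> (Sup x f) = (SUP a. feval M (\<rho>(x := a)) f)"
| "feval M \<rho> (Inf x f) = (INF a. feval M (\<rho>(x := a)) f)"

definition autM :: "('f, 'p, 'm::metric_space) mstruct \<Rightarrow> ('m \<Rightarrow> 'm) set" where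
  "autM M = {g. bij g \<and> (\<forall>x y. dist (g x) (g y) = dist x y) \<and>
     (\<forall>f xs. length xs = fun_ar M f \<longrightarrow> g (fun_int M f xs) = fun_int M f (map g xs)) \<and>
     (\<forall>p xs. length xs = pred_ar M p \<longrightarrow> pred_int M p (map g xs) = pred_int M p xs)}"

text \<open>The topology of pointwise convergence on Aut(M) is the subspace topology of the
  product topology on 'm \<Rightarrow> 'm (Function_Topology).\<close>

definition compatible_metric :: "('a::topological_space) set \<Rightarrow> ('a \<Rightarrow> 'a \<Rightarrow> real) \<Rightarrow> bool" where
  "compatible_metric G \<rho> \<longleftrightarrow> Metric_space G \<rho> \<and> Metric_space.mtopology G \<rho> = subtopology euclidean G"

definition \<Omega> :: "real measure" where
  "\<Omega> = restrict_space lborel {0..1}"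

definition aeq :: "(real \<Rightarrow> 'a) \<Rightarrow> (real \<Rightarrow> 'a) \<Rightarrow> bool" where
  "aeq r s \<longleftrightarrow> (AE \<omega> in \<Omega>. r \<omega> = s \<omega>)"

definition aecls :: "(real \<Rightarrow> 'a) set \<Rightarrow> (real \<Rightarrow> 'a) \<Rightarrow> (real \<Rightarrow> 'a) set" where
  "aecls S r = {s \<in> S. aeq s r}"

definition rep :: "(real \<Rightarrow> 'a) set \<Rightarrow> real \<Rightarrow> 'a" where
  "rep X = (SOME r. r \<in> X)"

definition L0M :: "(real \<Rightarrow> 'm::topological_space) set" where
  "L0M = borel_measurable \<Omega>"

definition L0A :: "(real \<Rightarrow> real) set" where
  "L0A = {R \<in> borel_measurable \<Omega>. \<forall>\<omega>\<in>space \<Omega>. R \<omega> \<in> {0..1}}"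

definition MainC :: "(real \<Rightarrow> 'm::topological_space) set set" where
  "MainC = aecls L0M ` L0M"

definition AuxC :: "(real \<Rightarrow> real) set set" where
  "AuxC = aecls L0A ` L0A"

definition dMain :: "(real \<Rightarrow> 'm::metric_space) set \<Rightarrow> (real \<Rightarrow> 'm) set \<Rightarrow> real" where
  "dMain X Y = (\<integral>\<omega>. dist (rep X \<omega>) (rep Y \<omega>) \<partial>\<Omega>)"

definition dAux :: "(real \<Rightarrow> real) set \<Rightarrow> (real \<Rightarrow> real) set \<Rightarrow> real" where
  "dAux X Y = (\<integral>\<omega>. \<bar>rep X \<omega> - rep Y \<omega>\<bar> \<partial>\<Omega>)"

definition EA :: "(real \<Rightarrow> real) set \<Rightarrow> real" where
  "EA X = (\<integral>\<omega>. rep X \<omega> \<partial>\<Omega>)"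

definition semR :: "('f, 'p, 'm::metric_space) mstruct \<Rightarrow> ('f, 'p) fml \<Rightarrow>
    (nat \<Rightarrow> (real \<Rightarrow> 'm) set) \<Rightarrow> (real \<Rightarrow> real) set" where
  "semR M \<phi> \<rho> = aecls L0A (\<lambda>\<omega>. feval M (\<lambda>i. rep (\<rho> i) \<omega>) \<phi>)"

definition connA :: "(real list \<Rightarrow> real) \<Rightarrow> (real \<Rightarrow> real) set list \<Rightarrow> (real \<Rightarrow> real) set" where
  "connA c Xs = aecls L0A (\<lambda>\<omega>. c (map (\<lambda>X. rep X \<omega>) Xs))"

type_synonym ('m) autR =
  "((real \<Rightarrow> 'm) set \<Rightarrow> (real \<Rightarrow> 'm) set) \<times> ((real \<Rightarrow> real) set \<Rightarrow> (real \<Rightarrow> real) set)"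

definition autMR :: "('f, 'p, 'm::metric_space) mstruct \<Rightarrow> 'm autR set" where
  "autMR M = {(\<Phi>, \<Psi>).
     bij_betw \<Phi> MainC MainC \<and> bij_betw \<Psi> AuxC AuxC \<and>
     (\<forall>X\<in>MainC. \<forall>Y\<in>MainC. dMain (\<Phi> X) (\<Phi> Y) = dMain X Y) \<and>
     (\<forall>X\<in>AuxC. \<forall>Y\<in>AuxC. dAux (\<Psi> X) (\<Psi> Y) = dAux X Y) \<and>
     (\<forall>\<phi> \<rho>. wf_fml M \<phi> \<and> (\<forall>i. \<rho> i \<in> MainC) \<longrightarrow> \<Psi> (semR M \<phi> \<rho>) = semR M \<phi> (\<Phi> \<circ> \<rho>)) \<and>
     (\<forall>X\<in>AuxC. EA (\<Psi> X) = EA X) \<and>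
     (\<forall>c Xs. conn_ok (length Xs) c \<and> set Xs \<subseteq> AuxC \<longrightarrow> \<Psi> (connA c Xs) = connA c (map \<Psi> Xs))}"

definition autR_eq :: "'m autR \<Rightarrow> 'm::topological_space autR \<Rightarrow> bool" where
  "autR_eq a b \<longleftrightarrow> (\<forall>X\<in>MainC. fst a X = fst b X) \<and> (\<forall>X\<in>AuxC. snd a X = snd b X)"

definition autR_comp :: "'m autR \<Rightarrow> 'm autR \<Rightarrow> 'm autR" where
  "autR_comp a b = (fst a \<circ> fst b, snd a \<circ> snd b)"

text \<open>Topology of pointwise convergence on Aut(M^R), expressed by convergence along filters.\<close>

definition autR_conv :: "'i filter \<Rightarrow> ('i \<Rightarrow> 'm autR) \<Rightarrow> 'm::metric_space autR \<Rightarrow> bool" where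
  "autR_conv F as a \<longleftrightarrow>
     (\<forall>X\<in>MainC. ((\<lambda>i. dMain (fst (as i) X) (fst a X)) \<longlongrightarrow> 0) F) \<and>
     (\<forall>X\<in>AuxC. ((\<lambda>i. dAux (snd (as i) X) (snd a X)) \<longlongrightarrow> 0) F)"

definition mp :: "(real \<Rightarrow> real) \<Rightarrow> bool" where
  "mp t \<longleftrightarrow> t \<in> measurable \<Omega> \<Omega> \<and> distr \<Omega> \<Omega> t = \<Omega>"

text \<open>Representatives of elements of Aut(\<Omega>): invertible (mod null sets) measure-preserving maps.\<close>

definition autOmega :: "(real \<Rightarrow> real) set" where
  "autOmega = {t. mp t \<and> (\<exists>s. mp s \<and> (AE \<omega> in \<Omega>. s (t \<omega>) = \<omega>) \<and> (AE \<omega> in \<Omega>. t (s \<omega>) = \<omega>))}"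

definition tinv :: "(real \<Rightarrow> real) \<Rightarrow> real \<Rightarrow> real" where
  "tinv t = (SOME s. mp s \<and> (AE \<omega> in \<Omega>. s (t \<omega>) = \<omega>) \<and> (AE \<omega> in \<Omega>. t (s \<omega>) = \<omega>))"

text \<open>Representatives of elements of G^\<Omega>: Borel maps \<Omega> \<rightarrow> Aut(M).\<close>

definition L0G :: "('f, 'p, 'm::metric_space) mstruct \<Rightarrow> (real \<Rightarrow> 'm \<Rightarrow> 'm) set" where
  "L0G M = {g. g \<in> borel_measurable \<Omega> \<and> (\<forall>\<omega>\<in>space \<Omega>. g \<omega> \<in> autM M)}"

text \<open>Multiplication in G^\<Omega> \<rtimes> Aut(\<Omega>), with (t\<cdot>g)(\<omega>) = g(t^{-1}\<omega>).\<close>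

definition wr_mult :: "((real \<Rightarrow> 'm \<Rightarrow> 'm) \<times> (real \<Rightarrow> real)) \<Rightarrow> ((real \<Rightarrow> 'm \<Rightarrow> 'm) \<times> (real \<Rightarrow> real))
    \<Rightarrow> ((real \<Rightarrow> 'm \<Rightarrow> 'm) \<times> (real \<Rightarrow> real))" where
  "wr_mult a b = ((\<lambda>\<omega>. fst a \<omega> \<circ> fst b (tinv (snd a) \<omega>)), snd a \<circ> snd b)"

definition convG :: "('f, 'p, 'm::metric_space) mstruct \<Rightarrow> 'i filter \<Rightarrow> ('i \<Rightarrow> real \<Rightarrow> 'm \<Rightarrow> 'm) \<Rightarrow> (real \<Rightarrow> 'm \<Rightarrow> 'm) \<Rightarrow> bool" where
  "convG M F gs g \<longleftrightarrow> (\<forall>\<rho>. compatible_metric (autM M) \<rho> \<longrightarrow>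
     (\<forall>e>0. ((\<lambda>i. measure \<Omega> {\<omega>\<in>space \<Omega>. \<rho> (gs i \<omega>) (g \<omega>) > e}) \<longlongrightarrow> 0) F))"

definition convOmega :: "'i filter \<Rightarrow> ('i \<Rightarrow> real \<Rightarrow> real) \<Rightarrow> (real \<Rightarrow> real) \<Rightarrow> bool" where
  "convOmega F ts t \<longleftrightarrow> (\<forall>A\<in>sets \<Omega>.
     ((\<lambda>i. measure \<Omega> (((ts i -` A \<inter> space \<Omega>) - (t -` A \<inter> space \<Omega>)) \<union>
                       ((t -` A \<inter> space \<Omega>) - (ts i -` A \<inter> space \<Omega>)))) \<longlongrightarrow> 0) F)"

definition wr_conv :: "('f, 'p, 'm::metric_space) mstruct \<Rightarrow> 'i filter \<Rightarrow>
    ('i \<Rightarrow> (real \<Rightarrow> 'm \<Rightarrow> 'm) \<times> (real \<Rightarrow> real)) \<Rightarrow> (real \<Rightarrow> 'm \<Rightarrow> 'm) \<times> (real \<Rightarrow> real) \<Rightarrow> bool" where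
  "wr_conv M F as a \<longleftrightarrow> convG M F (\<lambda>i. fst (as i)) (fst a) \<and> convOmega F (\<lambda>i. snd (as i)) (snd a)"

definition wr_act :: "(real \<Rightarrow> 'm \<Rightarrow> 'm) \<times> (real \<Rightarrow> real) \<Rightarrow> 'm::topological_space autR" where
  "wr_act a = ((\<lambda>X. aecls L0M (\<lambda>\<omega>. fst a \<omega> (rep X (tinv (snd a) \<omega>)))),
               (\<lambda>X. aecls L0A (\<lambda>\<omega>. rep X (tinv (snd a) \<omega>))))"

end

theory Submission
  imports Defs
begin

text \<open>
  Let \<open>(\<Phi>, \<Psi>)\<close> be an automorphism of the randomization and \<open>T = \<Psi> [id]\<close>. Continuous connectives give
  \<open>\<Psi> [c] = [c \<circ> T]\<close> for continuous \<open>c\<close>; preservation of expectations then says that \<open>T\<close> preserves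
  Lebesgue measure, density of the continuous functions in \<open>L\<^sup>1\<close> gives \<open>\<Psi> [R] = [R \<circ> T]\<close> for all \<open>R\<close>,
  and surjectivity of \<open>\<Psi>\<close> provides the inverse \<open>t\<close> of \<open>T\<close>. On the main sort, the images under \<open>\<Phi>\<close> of the
  constants from a countable dense set satisfy almost everywhere the same atomic conditions as the
  constants themselves, hence extend at almost every \<open>\<omega>\<close> to an embedding \<open>g \<omega>\<close>. Comparing the distances
  from \<open>\<Phi> r\<close> to these constants yields \<open>(\<Phi> r) \<omega> = g \<omega> (r (T \<omega>))\<close>, and surjectivity of \<open>\<Phi>\<close> makes
  \<open>g \<omega>\<close> onto.

  Both topologies are governed by convergence in measure, which does not depend on the choice of a
  compatible metric; approximating random elements by countably valued ones reduces it to constants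
  on the main sort and to indicators on the auxiliary one.
\<close>

subsection \<open>Dense sequences and isometries\<close>

definition dense_seq :: "(nat \<Rightarrow> 'a::topological_space) \<Rightarrow> bool" where
  "dense_seq d \<longleftrightarrow> closure (range d) = UNIV"

lemma dense_seqD:
  fixes d :: "nat \<Rightarrow> 'a::metric_space"
  assumes "dense_seq d" "e > 0"
  shows "\<exists>n. dist (d n) x < e"
  using assms by (auto simp: dense_seq_def set_eq_iff closure_approachable)

lemma dense_seq_exists:
  obtains d :: "nat \<Rightarrow> 'a::second_countable_topology" where "dense_seq d"
proof -
  obtain D :: "'a set" where D: "countable D" "\<And>X. open X \<Longrightarrow> X \<noteq> {} \<Longrightarrow> \<exists>x\<in>D. x \<in> X"
    by (rule countable_dense_setE) blast
  have "D \<noteq> {}" using D(2)[of UNIV] by auto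
  then have "range (from_nat_into D) = D" by (rule range_from_nat_into[OF _ D(1)])
  moreover have "closure D = UNIV"
    using D(2)[of "- closure D"] closure_subset[of D] by auto
  ultimately show ?thesis using that by (metis dense_seq_def)
qed

definition dense_index :: "(nat \<Rightarrow> 'a::metric_space) \<Rightarrow> real \<Rightarrow> 'a \<Rightarrow> nat" where
  "dense_index d e x = (LEAST n. dist (d n) x < e)"

lemma dist_dense_index: "dense_seq d \<Longrightarrow> e > 0 \<Longrightarrow> dist (d (dense_index d e x)) x < e"
  unfolding dense_index_def by (rule LeastI_ex) (rule dense_seqD)

definition dense_approx :: "(nat \<Rightarrow> 'a::metric_space) \<Rightarrow> nat \<Rightarrow> 'a \<Rightarrow> 'a" where
  "dense_approx d j x = d (dense_index d (inverse (Suc j)) x)"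

lemma dense_approx_tendsto:
  assumes "dense_seq d"
  shows "(\<lambda>j. dense_approx d j x) \<longlonglongrightarrow> x"
proof (rule metric_tendsto_imp_tendsto[OF LIMSEQ_inverse_real_of_nat])
  have "dist (dense_approx d j x) x < inverse (real (Suc j))" for j
    unfolding dense_approx_def by (rule dist_dense_index[OF assms]) simp
  then show "\<forall>\<^sub>F j in sequentially. dist (dense_approx d j x) x \<le> dist (inverse (real (Suc j))) 0"
    by (intro always_eventually allI) (simp add: less_imp_le)
qed

lemma measurable_dense_index:
  assumes [measurable]: "\<And>n. (\<lambda>\<omega>. dist (d n) (f \<omega>)) \<in> borel_measurable N"
  shows "(\<lambda>\<omega>. dense_index d e (f \<omega>)) \<in> measurable N (count_space UNIV)"
  unfolding dense_index_def by measurable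

lemma borel_measurable_if_dist:
  fixes f :: "'a \<Rightarrow> 'm::{metric_space, second_countable_topology}"
  assumes "\<And>x. (\<lambda>\<omega>. dist x (f \<omega>)) \<in> borel_measurable N"
  shows "f \<in> borel_measurable N"
proof -
  obtain d :: "nat \<Rightarrow> 'm" where d: "dense_seq d" by (rule dense_seq_exists)
  show ?thesis
  proof (rule borel_measurable_LIMSEQ_metric[OF _ dense_approx_tendsto[OF d]])
    show "(\<lambda>\<omega>. dense_approx d j (f \<omega>)) \<in> borel_measurable N" for j
      unfolding dense_approx_def by (rule measurable_compose[OF measurable_dense_index[OF assms]]) simp
  qed
qed

definition isometries :: "('a::metric_space \<Rightarrow> 'b::metric_space) set" where
  "isometries = {g. \<forall>x y. dist (g x) (g y) = dist x y}"

lemma dist_isometry: "g \<in> isometries \<Longrightarrow> dist (g x) (g y) = dist x y"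
  by (simp add: isometries_def)

lemma id_isometry: "(\<lambda>x. x) \<in> isometries"
  by (simp add: isometries_def)

lemma isometry_tendsto:
  assumes "g \<in> isometries" "(f \<longlongrightarrow> l) F"
  shows "((\<lambda>i. g (f i)) \<longlongrightarrow> g l) F"
  by (rule metric_tendsto_imp_tendsto[OF assms(2)]) (simp add: dist_isometry[OF assms(1)])

lemma inj_isometry: "g \<in> isometries \<Longrightarrow> inj g"
  by (rule injI) (metis dist_eq_0_iff dist_isometry)

lemma inv_isometry:
  assumes "g \<in> isometries" "surj g"
  shows "g (inv g y) = y" "inv g (g x) = x" "dist x (inv g y) = dist (g x) y"
  using assms surj_f_inv_f[of g] inv_f_f[OF inj_isometry] dist_isometry[OF assms(1), of x "inv g y"]
  by simp_all

lemma isometry_eqI_dist_dense_seq: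
  assumes g: "g \<in> isometries" and d: "dense_seq d" and eq: "\<And>n. dist y (g (d n)) = dist z (d n)"
  shows "y = g z"
proof -
  have "(\<lambda>j. dist y (g (dense_approx d j z))) \<longlonglongrightarrow> dist y (g z)"
    by (intro tendsto_dist tendsto_const isometry_tendsto[OF g] dense_approx_tendsto[OF d])
  moreover have "(\<lambda>j. dist y (g (dense_approx d j z))) \<longlonglongrightarrow> dist z z"
    unfolding dense_approx_def eq unfolding dense_approx_def[symmetric]
    by (intro tendsto_dist tendsto_const dense_approx_tendsto[OF d])
  ultimately have "dist y (g z) = dist z z" by (rule LIMSEQ_unique)
  then show ?thesis by simp
qed

lemma isometries_eqI_dense_seq:
  assumes "g \<in> isometries" "h \<in> isometries" "dense_seq d" "\<And>n. g (d n) = h (d n)"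
  shows "g = h"
  by (rule ext, rule isometry_eqI_dist_dense_seq[OF assms(2,3)])
    (simp add: dist_isometry[OF assms(1)] flip: assms(4))

lemma inj_on_comp_dense_seq: "dense_seq d \<Longrightarrow> inj_on (\<lambda>g. g \<circ> d) isometries"
  by (rule inj_onI, rule isometries_eqI_dense_seq[where d = d]) (simp_all add: fun_eq_iff)

lemma isometry_extension_dense_seq:
  fixes d :: "nat \<Rightarrow> 'a::metric_space" and k :: "nat \<Rightarrow> 'b::complete_space"
  assumes d: "dense_seq d" and iso: "\<And>n m. dist (k n) (k m) = dist (d n) (d m)"
  obtains g where "g \<in> isometries" "\<And>n. g (d n) = k n"
proof -
  define f where "f = k \<circ> inv d"
  have fd: "f (d n) = k n" for n
  proof -
    have "d (inv d (d n)) = d n" by (simp add: f_inv_into_f)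
    then have "dist (f (d n)) (k n) = 0" by (simp add: f_def iso)
    then show ?thesis by simp
  qed
  have "uniformly_continuous_on (range d) f"
    unfolding uniformly_continuous_on_def by (auto simp: fd iso)
  then obtain g where "uniformly_continuous_on UNIV g" and gd: "\<And>n. g (d n) = k n"
    using uniformly_continuous_on_extension_on_closure[of "range d" f] d fd
    unfolding dense_seq_def by (metis rangeI)
  then have g: "isCont g x" for x
    using uniformly_continuous_imp_continuous continuous_on_eq_continuous_at[OF open_UNIV] by blast
  have "dist (g x) (g y) = dist x y" for x y
  proof (rule LIMSEQ_unique)
    let ?dist = "\<lambda>j. dist (g (dense_approx d j x)) (g (dense_approx d j y))"
    show "?dist \<longlonglongrightarrow> dist (g x) (g y)"
      by (intro tendsto_dist isCont_tendsto_compose[OF g] dense_approx_tendsto[OF d])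
    have "?dist j = dist (dense_approx d j x) (dense_approx d j y)" for j
      by (simp add: dense_approx_def gd iso)
    then show "?dist \<longlonglongrightarrow> dist x y"
      by (simp add: tendsto_dist dense_approx_tendsto[OF d])
  qed
  with gd show ?thesis by (intro that[of g]) (simp_all add: isometries_def)
qed

lemma surj_isometry_if_dense_seq_in_range:
  fixes g :: "'a::complete_space \<Rightarrow> 'b::metric_space"
  assumes g: "g \<in> isometries" and d: "dense_seq d" and range: "range d \<subseteq> range g"
  shows "surj g"
proof -
  have "\<exists>x. y = g x" for y
  proof -
    define u where "u j = inv g (dense_approx d j y)" for j
    have "g (u j) = dense_approx d j y" for j
      using range by (simp add: u_def dense_approx_def f_inv_into_f subset_iff)
    then have lim: "(\<lambda>j. g (u j)) \<longlonglongrightarrow> y" using dense_approx_tendsto[OF d] by simp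
    then have "Cauchy u" using LIMSEQ_imp_Cauchy by (fastforce simp: Cauchy_def dist_isometry[OF g])
    then obtain x where "u \<longlonglongrightarrow> x" by (auto simp: Cauchy_convergent_iff convergent_def)
    then have "y = g x" by (intro LIMSEQ_unique[OF lim] isometry_tendsto[OF g])
    then show ?thesis ..
  qed
  then show ?thesis by (simp add: surj_def)
qed

subsection \<open>Pointwise convergence of isometries\<close>

lemma Metric_space_dist_image:
  assumes "inj_on f A"
  shows "Metric_space A (\<lambda>x y. dist (f x) (f y))"
  by standard (use assms in \<open>auto simp: dist_commute dist_triangle inj_on_def\<close>)

lemma mtopology_dist_image:
  assumes "inj_on f A"
  shows "Metric_space.mtopology A (\<lambda>x y. dist (f x) (f y)) = pullback_topology A f euclidean"
proof -
  interpret A: Metric_space A "\<lambda>x y. dist (f x) (f y)" by (rule Metric_space_dist_image[OF assms])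
  have "openin A.mtopology U \<longleftrightarrow> (\<exists>V. open V \<and> U = f -` V \<inter> A)" for U
  proof
    assume U: "openin A.mtopology U"
    let ?V = "\<Union>(x, r)\<in>{(x, r). x \<in> A \<and> A.mball x r \<subseteq> U}. ball (f x) r"
    have "U \<subseteq> f -` ?V"
    proof
      fix x assume "x \<in> U"
      then obtain r where "x \<in> A" "r > 0" "A.mball x r \<subseteq> U" using U unfolding A.openin_mtopology by blast
      then show "x \<in> f -` ?V" by (auto intro!: exI[of _ x] exI[of _ r])
    qed
    moreover have "f -` ?V \<inter> A \<subseteq> U" by (auto simp: A.mball_def subset_iff)
    moreover have "U \<subseteq> A" using U by (simp add: A.openin_mtopology)
    ultimately show "\<exists>V. open V \<and> U = f -` V \<inter> A" by (intro exI[of _ ?V]) auto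
  next
    assume "\<exists>V. open V \<and> U = f -` V \<inter> A"
    then show "openin A.mtopology U"
      by (fastforce simp: A.openin_mtopology open_contains_ball)
  qed
  then show ?thesis by (simp add: topology_eq openin_pullback_topology)
qed

lemma continuous_map_pullback_isometries_eval:
  fixes d :: "nat \<Rightarrow> 'a::metric_space" and G :: "('a \<Rightarrow> 'b::metric_space) set"
  assumes G: "G \<subseteq> isometries" and d: "dense_seq d"
  shows "continuous_map (pullback_topology G (\<lambda>g. g \<circ> d) euclidean) euclidean (\<lambda>g. g x)"
proof -
  let ?X = "pullback_topology G (\<lambda>g. g \<circ> d) euclidean"
  have "continuous_map ?X Met_TC.mtopology (\<lambda>g. g x)"
  proof (rule Met_TC.continuous_map_uniform_limit[where F = sequentially])
    have "continuous_map ?X euclidean ((\<lambda>v. v n) \<circ> (\<lambda>g. g \<circ> d))" for n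
      by (rule continuous_map_pullback) simp
    then have "continuous_map ?X Met_TC.mtopology (\<lambda>g. g (d n))" for n
      by (simp add: comp_def)
    then show "\<forall>\<^sub>F j in sequentially. continuous_map ?X Met_TC.mtopology (\<lambda>g. g (dense_approx d j x))"
      by (simp add: dense_approx_def)
    fix e :: real assume "e > 0"
    then have "\<forall>\<^sub>F j in sequentially. dist (dense_approx d j x) x < e"
      using dense_approx_tendsto[OF d] by (auto dest: tendstoD)
    then show "\<forall>\<^sub>F j in sequentially. \<forall>g\<in>topspace ?X.
        g x \<in> UNIV \<and> dist (g (dense_approx d j x)) (g x) < e"
      by eventually_elim (use G in \<open>auto simp: topspace_pullback_topology dist_isometry subset_iff\<close>)
  qed simp
  then show ?thesis by simp
qed

lemma top_of_set_isometries_eq_pullback: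
  fixes d :: "nat \<Rightarrow> 'a::metric_space" and G :: "('a \<Rightarrow> 'b::metric_space) set"
  assumes "G \<subseteq> isometries" "dense_seq d"
  shows "top_of_set G = pullback_topology G (\<lambda>g. g \<circ> d) euclidean"
proof -
  let ?X = "pullback_topology G (\<lambda>g. g \<circ> d) euclidean"
  have "continuous_map (top_of_set G) euclidean (\<lambda>g. g \<circ> d)"
    unfolding comp_def continuous_map_iff_continuous
    by (intro continuous_on_coordinatewise_then_product continuous_on_subset[OF continuous_on_product_coordinates])
      simp
  then have "openin (top_of_set G) U" if "openin ?X U" for U
    using that
    by (auto simp: openin_pullback_topology Int_commute dest: continuous_openin_preimage_gen)
  moreover have "openin ?X U" if U: "openin (top_of_set G) U" for U
  proof -
    have "continuous_map ?X (product_topology (\<lambda>_. euclidean) UNIV) (\<lambda>g. g)"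
      using continuous_map_pullback_isometries_eval[OF assms] by (simp add: continuous_map_componentwise_UNIV)
    then have "continuous_map ?X euclidean (\<lambda>g. g)" by (simp add: euclidean_product_topology)
    moreover obtain W where "open W" "U = G \<inter> W" using U by (auto simp: openin_open)
    ultimately show ?thesis
      using openin_continuous_map_preimage[of ?X euclidean "\<lambda>g. g" W]
      by (simp add: topspace_pullback_topology Int_def)
  qed
  ultimately show ?thesis by (auto simp: topology_eq)
qed

definition seq_dist :: "(nat \<Rightarrow> 'a) \<Rightarrow> ('a \<Rightarrow> 'b::metric_space) \<Rightarrow> ('a \<Rightarrow> 'b) \<Rightarrow> real" where
  "seq_dist d g h = dist (g \<circ> d) (h \<circ> d)"

lemma compatible_metric_seq_dist:
  fixes d :: "nat \<Rightarrow> 'a::metric_space"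
  assumes "G \<subseteq> isometries" "dense_seq d"
  shows "compatible_metric G (seq_dist d)"
proof -
  have "inj_on (\<lambda>g. g \<circ> d) G"
    using inj_on_comp_dense_seq[OF assms(2)] assms(1) by (rule inj_on_subset)
  then show ?thesis
    unfolding compatible_metric_def seq_dist_def[abs_def] top_of_set_isometries_eq_pullback[OF assms]
    by (intro conjI Metric_space_dist_image mtopology_dist_image)
qed

lemma borel_measurable_isometriesI:
  fixes g :: "'w \<Rightarrow> 'a::metric_space \<Rightarrow> 'b::{metric_space, second_countable_topology}"
  assumes d: "dense_seq d" and iso: "\<And>\<omega>. \<omega> \<in> space N \<Longrightarrow> g \<omega> \<in> isometries"
    and meas: "\<And>n. (\<lambda>\<omega>. g \<omega> (d n)) \<in> borel_measurable N"
  shows "g \<in> borel_measurable N"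
proof (rule borel_measurableI)
  fix U :: "('a \<Rightarrow> 'b) set" assume "open U"
  then have "openin (top_of_set isometries) (U \<inter> isometries)" by (auto simp: openin_open)
  then obtain V where V: "open V" "U \<inter> isometries = (\<lambda>f. f \<circ> d) -` V \<inter> isometries"
    unfolding top_of_set_isometries_eq_pullback[OF order_refl d] openin_pullback_topology by auto
  have "(\<lambda>\<omega>. g \<omega> \<circ> d) \<in> borel_measurable N"
    unfolding comp_def by (rule measurable_coordinatewise_then_product) (rule meas)
  then have "(\<lambda>\<omega>. g \<omega> \<circ> d) -` V \<inter> space N \<in> sets N"
    by (rule measurable_sets) (use V(1) in simp)
  also have "(\<lambda>\<omega>. g \<omega> \<circ> d) -` V \<inter> space N = g -` U \<inter> space N" using V(2) iso by auto
  finally show "g -` U \<inter> space N \<in> sets N" .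
qed

lemma borel_measurable_isometry_apply:
  fixes g :: "'w \<Rightarrow> 'a::{metric_space, second_countable_topology} \<Rightarrow> 'b::metric_space"
  assumes iso: "\<And>\<omega>. \<omega> \<in> space N \<Longrightarrow> g \<omega> \<in> isometries"
    and meas: "\<And>x. (\<lambda>\<omega>. g \<omega> x) \<in> borel_measurable N" and r: "r \<in> borel_measurable N"
  shows "(\<lambda>\<omega>. g \<omega> (r \<omega>)) \<in> borel_measurable N"
proof -
  obtain d :: "nat \<Rightarrow> 'a" where d: "dense_seq d" by (rule dense_seq_exists)
  show ?thesis
  proof (rule borel_measurable_LIMSEQ_metric)
    fix j
    have "(\<lambda>\<omega>. dense_index d (inverse (Suc j)) (r \<omega>)) \<in> measurable N (count_space UNIV)"
      by (rule measurable_dense_index[OF borel_measurable_dist[OF borel_measurable_const r]])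
    then show "(\<lambda>\<omega>. g \<omega> (dense_approx d j (r \<omega>))) \<in> borel_measurable N"
      unfolding dense_approx_def
      by (rule measurable_compose_countable[where f = "\<lambda>n \<omega>. g \<omega> (d n)", OF meas])
  next
    show "(\<lambda>j. g \<omega> (dense_approx d j (r \<omega>))) \<longlonglongrightarrow> g \<omega> (r \<omega>)" if "\<omega> \<in> space N" for \<omega>
      by (rule isometry_tendsto[OF iso[OF that] dense_approx_tendsto[OF d]])
  qed
qed

lemma borel_measurable_isometry_inv_apply:
  fixes g :: "'w \<Rightarrow> 'a::{metric_space, second_countable_topology}
      \<Rightarrow> 'b::{metric_space, second_countable_topology}"
  assumes iso: "\<And>\<omega>. \<omega> \<in> space N \<Longrightarrow> g \<omega> \<in> isometries \<and> surj (g \<omega>)"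
    and meas: "\<And>x. (\<lambda>\<omega>. g \<omega> x) \<in> borel_measurable N" and r: "r \<in> borel_measurable N"
  shows "(\<lambda>\<omega>. inv (g \<omega>) (r \<omega>)) \<in> borel_measurable N"
proof (rule borel_measurable_if_dist)
  fix x
  have "(\<lambda>\<omega>. dist (g \<omega> x) (r \<omega>)) \<in> borel_measurable N"
    by (intro borel_measurable_dist meas r)
  then show "(\<lambda>\<omega>. dist x (inv (g \<omega>) (r \<omega>))) \<in> borel_measurable N"
    by (rule measurable_cong[THEN iffD1, rotated]) (use iso in \<open>simp add: inv_isometry(3)\<close>)
qed

subsection \<open>The product metric\<close>

lemma summable_dist_fun:
  fixes v w :: "'k::countable \<Rightarrow> 'a::metric_space"
  shows "summable (\<lambda>n. (1/2)^n * min (dist (v (from_nat n)) (w (from_nat n))) 1)"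
  by (rule summable_comparison_test'[of "\<lambda>n. (1/2)^n"]) auto

lemma min_dist_coordinate_le_dist_fun:
  fixes v w :: "'k::countable \<Rightarrow> 'a::metric_space"
  shows "min (dist (v k) (w k)) 1 \<le> 2 ^ to_nat k * dist v w"
proof -
  have "(1/2) ^ to_nat k * min (dist (v k) (w k)) 1 \<le> dist v w"
    unfolding dist_fun_def using sum_le_suminf[OF summable_dist_fun[of v w], of "{to_nat k}"] by force
  then show ?thesis by (simp add: field_simps)
qed

lemma uniformly_continuous_on_coordinate:
  "uniformly_continuous_on S (\<lambda>\<rho> :: 'k::countable \<Rightarrow> 'a::metric_space. \<rho> k)"
  unfolding uniformly_continuous_on_def
proof (intro allI impI)
  fix e :: real assume "e > 0"
  have "dist (\<rho>' k) (\<rho> k) < e" if "dist \<rho>' \<rho> < min e 1 / 2 ^ to_nat k" for \<rho> \<rho>' :: "'k \<Rightarrow> 'a"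
  proof -
    have "min (dist (\<rho>' k) (\<rho> k)) 1 \<le> 2 ^ to_nat k * dist \<rho>' \<rho>" by (rule min_dist_coordinate_le_dist_fun)
    also have "\<dots> < min e 1" using that by (simp add: field_simps)
    finally show ?thesis by auto
  qed
  then show "\<exists>d>0. \<forall>\<rho>\<in>S. \<forall>\<rho>'\<in>S. dist \<rho>' \<rho> < d \<longrightarrow> dist (\<rho>' k) (\<rho> k) < e"
    using \<open>e > 0\<close> by (intro exI[of _ "min e 1 / 2 ^ to_nat k"]) simp
qed

lemma dist_fun_upd_le:
  fixes v w :: "'k::countable \<Rightarrow> 'a::metric_space"
  shows "dist (v(k := a)) (w(k := a)) \<le> dist v w"
  unfolding dist_fun_def by (intro suminf_le summable_dist_fun) (auto intro!: mult_left_mono)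

lemma dist_fun_less_if_coordinates:
  assumes "e > 0"
  obtains K :: "'k::countable set" and c where "finite K" "c > 0"
    "\<And>v w :: 'k \<Rightarrow> 'a::metric_space. (\<And>k. k \<in> K \<Longrightarrow> dist (v k) (w k) \<le> c) \<Longrightarrow> dist v w < e"
proof -
  obtain N where N: "(1/2) ^ N < e / 2" using real_arch_pow_inv[of "e/2" "1/2"] assms by auto
  have "dist v w < e" if "\<And>k. k \<in> from_nat ` {..N} \<Longrightarrow> dist (v k) (w k) \<le> e / 4" for v w :: "'k \<Rightarrow> 'a"
  proof -
    have "Max {dist (v (from_nat n)) (w (from_nat n)) | n. n \<le> N} \<le> e / 4"
      using that by (subst Max_le_iff) auto
    then show ?thesis using dist_fun_le_dist_first_terms[of v w N] N by linarith
  qed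
  then show ?thesis using assms by (intro that[of "from_nat ` {..N}" "e / 4"]) auto
qed

subsection \<open>Convergence in measure\<close>

definition tendsto_0_in_measure :: "'w measure \<Rightarrow> 'i filter \<Rightarrow> ('i \<Rightarrow> 'w \<Rightarrow> real) \<Rightarrow> bool" where
  "tendsto_0_in_measure N F f \<longleftrightarrow>
     (\<forall>e>0. ((\<lambda>i. measure N {\<omega> \<in> space N. f i \<omega> > e}) \<longlongrightarrow> 0) F)"

lemma tendsto_0_in_measureD:
  "tendsto_0_in_measure N F f \<Longrightarrow> e > 0 \<Longrightarrow> ((\<lambda>i. measure N {\<omega> \<in> space N. f i \<omega> > e}) \<longlongrightarrow> 0) F"
  by (simp add: tendsto_0_in_measure_def)

lemma tendsto_0_if_le_add:
  fixes f :: "'i \<Rightarrow> real"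
  assumes "\<And>i. 0 \<le> f i" and "\<And>e. e > 0 \<Longrightarrow> \<exists>b. (b \<longlongrightarrow> 0) F \<and> (\<forall>i. f i \<le> b i + e)"
  shows "(f \<longlongrightarrow> 0) F"
proof (rule tendstoI)
  fix e :: real assume "e > 0"
  then obtain b where b: "(b \<longlongrightarrow> 0) F" "\<And>i. f i \<le> b i + e / 2" using assms(2)[of "e / 2"] by auto
  have "\<forall>\<^sub>F i in F. b i < e / 2" using b(1) \<open>e > 0\<close> by (intro order_tendstoD(2)) auto
  then show "\<forall>\<^sub>F i in F. dist (f i) 0 < e"
    by eventually_elim (use b(2) assms(1) in \<open>force simp: dist_real_def intro: le_less_trans\<close>)
qed

context finite_measure
begin

lemma measure_UN_tendsto_0:
  assumes "finite K" "\<And>k i. k \<in> K \<Longrightarrow> D k i \<in> sets M" "\<And>k. k \<in> K \<Longrightarrow> ((\<lambda>i. measure M (D k i)) \<longlongrightarrow> 0) F"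
  shows "((\<lambda>i. measure M (\<Union>k\<in>K. D k i)) \<longlongrightarrow> 0) F"
proof (rule tendsto_sandwich[OF _ _ tendsto_const])
  show "\<forall>\<^sub>F i in F. measure M (\<Union>k\<in>K. D k i) \<le> (\<Sum>k\<in>K. measure M (D k i))"
    using assms(1,2) by (intro always_eventually allI measure_UNION_le) auto
  show "((\<lambda>i. \<Sum>k\<in>K. measure M (D k i)) \<longlongrightarrow> 0) F"
    using assms(3) by (rule tendsto_null_sum)
qed simp

lemma ex_measure_nat_ge_less:
  fixes K :: "'a \<Rightarrow> nat"
  assumes [measurable]: "K \<in> measurable M (count_space UNIV)" and "e > 0"
  shows "\<exists>n. measure M {\<omega> \<in> space M. n \<le> K \<omega>} < e"
proof -
  let ?A = "\<lambda>n. {\<omega> \<in> space M. n \<le> K \<omega>}"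
  have "range ?A \<subseteq> sets M" "decseq ?A" by (auto simp: decseq_def)
  then have "(\<lambda>n. measure M (?A n)) \<longlonglongrightarrow> measure M (\<Inter>n. ?A n)"
    by (rule finite_Lim_measure_decseq)
  moreover have "(\<Inter>n. ?A n) = {}" by auto (metis Suc_n_not_le_n)
  ultimately have "\<forall>\<^sub>F n in sequentially. measure M (?A n) < e"
    using \<open>e > 0\<close> by (intro order_tendstoD(2)) auto
  then show ?thesis by (auto simp: eventually_sequentially)
qed

lemma measure_tendsto_0_if_covered:
  fixes K :: "'a \<Rightarrow> nat"
  assumes K [measurable]: "K \<in> measurable M (count_space UNIV)" and D: "\<And>k i. D k i \<in> sets M"
    and conv: "\<And>k. ((\<lambda>i. measure M (D k i)) \<longlongrightarrow> 0) F"
    and cover: "\<And>i. A i \<subseteq> {\<omega> \<in> space M. \<omega> \<in> D (K \<omega>) i}"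
  shows "((\<lambda>i. measure M (A i)) \<longlongrightarrow> 0) F"
proof (rule tendsto_0_if_le_add)
  fix e :: real assume "e > 0"
  then obtain n where n: "measure M {\<omega> \<in> space M. n \<le> K \<omega>} < e" using ex_measure_nat_ge_less[OF K] by blast
  let ?D = "\<lambda>i. \<Union>k\<in>{..<n}. D k i" and ?B = "{\<omega> \<in> space M. n \<le> K \<omega>}"
  have "measure M (A i) \<le> measure M (?D i) + e" for i
  proof -
    have "A i \<subseteq> ?D i \<union> ?B" using cover[of i] by (force simp: not_le)
    then have "measure M (A i) \<le> measure M (?D i \<union> ?B)" using D by (intro finite_measure_mono) auto
    also have "\<dots> \<le> measure M (?D i) + measure M ?B" using D by (intro measure_Un_le) auto
    finally show ?thesis using n by simp
  qed
  moreover have "((\<lambda>i. measure M (?D i)) \<longlongrightarrow> 0) F"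
    by (intro measure_UN_tendsto_0 finite_lessThan D conv)
  ultimately show "\<exists>b. (b \<longlongrightarrow> 0) F \<and> (\<forall>i. measure M (A i) \<le> b i + e)" by blast
qed simp

lemma measure_tendsto_0_mono:
  assumes "((\<lambda>i. measure M (D i)) \<longlongrightarrow> 0) F" "\<And>i. D i \<in> sets M" "\<And>i. A i \<subseteq> D i"
  shows "((\<lambda>i. measure M (A i)) \<longlongrightarrow> 0) F"
  using assms by (intro tendsto_sandwich[OF _ _ tendsto_const assms(1)]) (simp_all add: finite_measure_mono)

lemma tendsto_0_in_measure_mono:
  assumes h: "tendsto_0_in_measure M F h" and [measurable]: "\<And>i. h i \<in> borel_measurable M"
    and le: "\<And>i \<omega>. \<omega> \<in> space M \<Longrightarrow> f i \<omega> \<le> h i \<omega>"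
  shows "tendsto_0_in_measure M F f"
  unfolding tendsto_0_in_measure_def
proof (intro allI impI)
  fix e :: real assume "e > 0"
  from tendsto_0_in_measureD[OF h this]
  show "((\<lambda>i. measure M {\<omega> \<in> space M. e < f i \<omega>}) \<longlongrightarrow> 0) F"
    by (rule measure_tendsto_0_mono) (use le in \<open>force intro: less_le_trans\<close>)+
qed

lemma tendsto_0_in_measure_add:
  assumes f: "tendsto_0_in_measure M F f" and h: "tendsto_0_in_measure M F h"
    and [measurable]: "\<And>i. f i \<in> borel_measurable M" "\<And>i. h i \<in> borel_measurable M"
  shows "tendsto_0_in_measure M F (\<lambda>i \<omega>. f i \<omega> + h i \<omega>)"
  unfolding tendsto_0_in_measure_def
proof (intro allI impI)
  fix e :: real assume "e > 0"
  show "((\<lambda>i. measure M {\<omega> \<in> space M. e < f i \<omega> + h i \<omega>}) \<longlongrightarrow> 0) F"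
  proof (rule tendsto_sandwich[OF _ _ tendsto_const])
    show "((\<lambda>i. measure M {\<omega> \<in> space M. e / 2 < f i \<omega>} + measure M {\<omega> \<in> space M. e / 2 < h i \<omega>}) \<longlongrightarrow> 0) F"
      using \<open>e > 0\<close> by (intro tendsto_add_zero tendsto_0_in_measureD f h) auto
    have "measure M {\<omega> \<in> space M. e < f i \<omega> + h i \<omega>}
        \<le> measure M ({\<omega> \<in> space M. e / 2 < f i \<omega>} \<union> {\<omega> \<in> space M. e / 2 < h i \<omega>})" for i
      by (intro finite_measure_mono) auto
    then show "\<forall>\<^sub>F i in F. measure M {\<omega> \<in> space M. e < f i \<omega> + h i \<omega>}
        \<le> measure M {\<omega> \<in> space M. e / 2 < f i \<omega>} + measure M {\<omega> \<in> space M. e / 2 < h i \<omega>}"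
      by (intro always_eventually allI order_trans[OF _ measure_Un_le]) auto
  qed simp
qed

end

context prob_space
begin

lemma integral_tendsto_0_if_in_measure:
  assumes conv: "tendsto_0_in_measure M F f" and [measurable]: "\<And>i. f i \<in> borel_measurable M"
    and bounds: "\<And>i \<omega>. \<omega> \<in> space M \<Longrightarrow> 0 \<le> f i \<omega>" "\<And>i \<omega>. \<omega> \<in> space M \<Longrightarrow> f i \<omega> \<le> 1"
  shows "((\<lambda>i. \<integral>\<omega>. f i \<omega> \<partial>M) \<longlongrightarrow> 0) F"
proof (rule tendsto_0_if_le_add)
  show "0 \<le> (\<integral>\<omega>. f i \<omega> \<partial>M)" for i
    using bounds(1) by (intro Bochner_Integration.integral_nonneg)
  fix e :: real assume "e > 0"
  let ?A = "\<lambda>i. {\<omega> \<in> space M. f i \<omega> > e}"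
  have ind: "integrable M (indicator (?A i) :: 'a \<Rightarrow> real)" for i
    by (rule integrable_real_indicator) (simp_all flip: less_top)
  have "(\<integral>\<omega>. f i \<omega> \<partial>M) \<le> (\<integral>\<omega>. indicator (?A i) \<omega> + e \<partial>M)" for i
  proof (rule integral_mono)
    show "integrable M (f i)"
      using bounds by (intro integrable_const_bound[of _ 1]) auto
    show "f i \<omega> \<le> indicator (?A i) \<omega> + e" if "\<omega> \<in> space M" for \<omega>
      using that bounds(2)[OF that, of i] \<open>e > 0\<close> by (auto simp: indicator_def)
  qed (simp add: ind)
  also have "(\<integral>\<omega>. indicator (?A i) \<omega> + e \<partial>M) = measure M (?A i) + e" for i
    by (subst Bochner_Integration.integral_add[OF ind]) (simp_all add: prob_space)
  finally show "\<exists>b. (b \<longlongrightarrow> 0) F \<and> (\<forall>i. (\<integral>\<omega>. f i \<omega> \<partial>M) \<le> b i + e)"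
    using tendsto_0_in_measureD[OF conv \<open>e > 0\<close>] by blast
qed

lemma tendsto_0_in_measure_if_integral:
  assumes conv: "((\<lambda>i. \<integral>\<omega>. f i \<omega> \<partial>M) \<longlongrightarrow> 0) F" and int: "\<And>i. integrable M (f i)"
    and nonneg: "\<And>i \<omega>. \<omega> \<in> space M \<Longrightarrow> 0 \<le> f i \<omega>"
  shows "tendsto_0_in_measure M F f"
  unfolding tendsto_0_in_measure_def
proof (intro allI impI)
  have [measurable]: "f i \<in> borel_measurable M" for i using int by simp
  fix e :: real assume "e > 0"
  have "measure M {\<omega> \<in> space M. f i \<omega> > e} \<le> (\<integral>\<omega>. f i \<omega> \<partial>M) / e" for i
  proof -
    have "measure M {\<omega> \<in> space M. f i \<omega> > e} \<le> measure M {\<omega> \<in> space M. f i \<omega> \<ge> e}"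
      by (intro finite_measure_mono) auto
    also have "\<dots> \<le> (\<integral>\<omega>. f i \<omega> \<partial>M) / e"
      using nonneg \<open>e > 0\<close> by (intro integral_Markov_inequality_measure[OF int sets.top] AE_I2)
    finally show ?thesis .
  qed
  then show "((\<lambda>i. measure M {\<omega> \<in> space M. f i \<omega> > e}) \<longlongrightarrow> 0) F"
    by (intro tendsto_sandwich[OF _ _ tendsto_const tendsto_divide_zero[OF conv, of e]]) simp_all
qed

end

context finite_measure
begin

lemma tendsto_0_in_measure_coordinate:
  fixes u :: "'i \<Rightarrow> 'a \<Rightarrow> 'k::countable \<Rightarrow> 'b::{metric_space, second_countable_topology}"
  assumes conv: "tendsto_0_in_measure M F (\<lambda>i \<omega>. dist (u i \<omega>) (v \<omega>))"
    and "\<And>i k. (\<lambda>\<omega>. u i \<omega> k) \<in> borel_measurable M" "\<And>k. (\<lambda>\<omega>. v \<omega> k) \<in> borel_measurable M"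
  shows "tendsto_0_in_measure M F (\<lambda>i \<omega>. dist (u i \<omega> k) (v \<omega> k))"
  unfolding tendsto_0_in_measure_def
proof (intro allI impI)
  have [measurable]: "(\<lambda>\<omega>. dist (u i \<omega>) (v \<omega>)) \<in> borel_measurable M" for i
    by (intro borel_measurable_dist measurable_coordinatewise_then_product assms)
  fix e :: real assume "e > 0"
  define c where "c = min e (1 / 2) / 2 ^ to_nat k"
  have "c > 0" using \<open>e > 0\<close> by (simp add: c_def)
  have "dist x y > c" if "dist (x k) (y k) > e" for x y :: "'k \<Rightarrow> 'b"
  proof -
    have "min e (1 / 2) < min (dist (x k) (y k)) 1" using that by (auto simp: min_def)
    also have "\<dots> \<le> 2 ^ to_nat k * dist x y" by (rule min_dist_coordinate_le_dist_fun)
    finally show ?thesis by (simp add: c_def divide_less_eq mult.commute)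
  qed
  then show "((\<lambda>i. measure M {\<omega> \<in> space M. e < dist (u i \<omega> k) (v \<omega> k)}) \<longlongrightarrow> 0) F"
    by (intro measure_tendsto_0_mono[OF tendsto_0_in_measureD[OF conv \<open>c > 0\<close>]]) auto
qed

lemma tendsto_0_in_measure_coordinatewise:
  fixes u :: "'i \<Rightarrow> 'a \<Rightarrow> 'k::countable \<Rightarrow> 'b::{metric_space, second_countable_topology}"
  assumes conv: "\<And>k. tendsto_0_in_measure M F (\<lambda>i \<omega>. dist (u i \<omega> k) (v \<omega> k))"
    and "\<And>i k. (\<lambda>\<omega>. u i \<omega> k) \<in> borel_measurable M" "\<And>k. (\<lambda>\<omega>. v \<omega> k) \<in> borel_measurable M"
  shows "tendsto_0_in_measure M F (\<lambda>i \<omega>. dist (u i \<omega>) (v \<omega>))"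
  unfolding tendsto_0_in_measure_def
proof (intro allI impI)
  have [measurable]: "(\<lambda>\<omega>. dist (u i \<omega> k) (v \<omega> k)) \<in> borel_measurable M" for i k
    by (intro borel_measurable_dist assms)
  fix e :: real assume "e > 0"
  obtain K c where K: "finite K" "c > 0"
    "\<And>x y :: 'k \<Rightarrow> 'b. (\<And>k. k \<in> K \<Longrightarrow> dist (x k) (y k) \<le> c) \<Longrightarrow> dist x y < e"
    by (rule dist_fun_less_if_coordinates[OF \<open>e > 0\<close>]) blast
  have "((\<lambda>i. measure M (\<Union>k\<in>K. {\<omega> \<in> space M. c < dist (u i \<omega> k) (v \<omega> k)})) \<longlongrightarrow> 0) F"
    using K(1,2) by (intro measure_UN_tendsto_0 tendsto_0_in_measureD[OF conv]) auto
  then show "((\<lambda>i. measure M {\<omega> \<in> space M. e < dist (u i \<omega>) (v \<omega>)}) \<longlongrightarrow> 0) F"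
  proof (rule measure_tendsto_0_mono)
    show "{\<omega> \<in> space M. e < dist (u i \<omega>) (v \<omega>)} \<subseteq> (\<Union>k\<in>K. {\<omega> \<in> space M. c < dist (u i \<omega> k) (v \<omega> k)})" for i
      using K(3) by (force simp: not_less)
  qed (use K(1) in auto)
qed

end

lemma compatible_metrics_exceptional_sets:
  assumes "Metric_space S \<rho>" "Metric_space S \<sigma>"
    and top: "Metric_space.mtopology S \<rho> = Metric_space.mtopology S \<sigma>" and "e > 0"
  obtains W :: "nat \<Rightarrow> 'a set" where "\<And>k. openin (Metric_space.mtopology S \<rho>) (W k)" "(\<Inter>k. W k) = {}"
    "\<And>k x y. \<lbrakk>x \<in> S; y \<in> S - W k; \<rho> x y < inverse (Suc k)\<rbrakk> \<Longrightarrow> \<sigma> x y \<le> e"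
proof
  interpret R: Metric_space S \<rho> by fact
  interpret S: Metric_space S \<sigma> by fact
  define W where "W k = (\<Union>x\<in>S. R.mball x (inverse (Suc k)) \<inter> (S - S.mcball x e))" for k
  have "openin R.mtopology (R.mball x r \<inter> (S - S.mcball x e))" for x r
    using openin_diff[OF openin_topspace S.closedin_mcball[of x e]] R.openin_mball[of x r]
    by (intro openin_Int) (simp_all add: top)
  then show "openin R.mtopology (W k)" for k unfolding W_def by blast
  show "(\<Inter>k. W k) = {}"
  proof (rule ccontr)
    assume "(\<Inter>k. W k) \<noteq> {}"
    then obtain y where y: "\<And>k. y \<in> W k" by auto
    then have "y \<in> S" by (auto simp: W_def)
    then obtain r where r: "r > 0" "R.mball y r \<subseteq> S.mball y e"
      using S.openin_mball[of y e] \<open>e > 0\<close> by (auto simp flip: top simp: R.openin_mtopology)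
    obtain k where "inverse (Suc k) < r" using reals_Archimedean[OF r(1)] by auto
    then show False using y[of k] r(2) by (force simp: W_def R.commute S.commute)
  qed
  show "\<sigma> x y \<le> e" if "x \<in> S" "y \<in> S - W k" "\<rho> x y < inverse (Suc k)" for k x y
    using that by (fastforce simp: W_def)
qed

lemma (in finite_measure) tendsto_0_in_measure_change_metric:
  fixes S :: "'b set"
  assumes conv: "tendsto_0_in_measure M F (\<lambda>i \<omega>. \<rho> (f i \<omega>) (g \<omega>))"
    and metrics: "Metric_space S \<rho>" "Metric_space S \<sigma>"
      "Metric_space.mtopology S \<rho> = Metric_space.mtopology S \<sigma>"
    and f: "\<And>i \<omega>. \<omega> \<in> space M \<Longrightarrow> f i \<omega> \<in> S" and g: "\<And>\<omega>. \<omega> \<in> space M \<Longrightarrow> g \<omega> \<in> S"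
    and g_meas: "\<And>U. openin (Metric_space.mtopology S \<rho>) U \<Longrightarrow> {\<omega> \<in> space M. g \<omega> \<in> U} \<in> sets M"
    and [measurable]: "\<And>i. (\<lambda>\<omega>. \<rho> (f i \<omega>) (g \<omega>)) \<in> borel_measurable M"
  shows "tendsto_0_in_measure M F (\<lambda>i \<omega>. \<sigma> (f i \<omega>) (g \<omega>))"
  unfolding tendsto_0_in_measure_def
proof (intro allI impI)
  fix e :: real assume "e > 0"
  obtain W :: "nat \<Rightarrow> 'b set" where W: "\<And>k. openin (Metric_space.mtopology S \<rho>) (W k)" "(\<Inter>k. W k) = {}"
    and close: "\<And>k x y. \<lbrakk>x \<in> S; y \<in> S - W k; \<rho> x y < inverse (Suc k)\<rbrakk> \<Longrightarrow> \<sigma> x y \<le> e"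
    by (rule compatible_metrics_exceptional_sets[OF metrics \<open>e > 0\<close>]) blast
  have [measurable]: "{\<omega> \<in> space M. g \<omega> \<in> W k} \<in> sets M" for k by (rule g_meas[OF W(1)])
  define K where "K \<omega> = (LEAST k. g \<omega> \<notin> W k)" for \<omega>
  have "\<exists>k. g \<omega> \<notin> W k" for \<omega> using W(2) by auto
  then have "g \<omega> \<notin> W (K \<omega>)" for \<omega> unfolding K_def by (rule LeastI_ex)
  define D where "D k i = {\<omega> \<in> space M. inverse (Suc (Suc k)) < \<rho> (f i \<omega>) (g \<omega>)}" for k i
  show "((\<lambda>i. measure M {\<omega> \<in> space M. e < \<sigma> (f i \<omega>) (g \<omega>)}) \<longlongrightarrow> 0) F"
  proof (rule measure_tendsto_0_if_covered)
    show "K \<in> measurable M (count_space UNIV)" unfolding K_def[abs_def] by measurable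
    show "D k i \<in> sets M" for k i unfolding D_def by measurable
    show "((\<lambda>i. measure M (D k i)) \<longlongrightarrow> 0) F" for k
      unfolding D_def by (rule tendsto_0_in_measureD[OF conv]) simp
    have "\<sigma> (f i \<omega>) (g \<omega>) \<le> e" if "\<omega> \<in> space M" "\<omega> \<notin> D (K \<omega>) i" for i \<omega>
    proof (rule close)
      have "\<rho> (f i \<omega>) (g \<omega>) \<le> inverse (real (Suc (Suc (K \<omega>))))" using that by (simp add: D_def)
      also have "\<dots> < inverse (real (Suc (K \<omega>)))" by simp
      finally show "\<rho> (f i \<omega>) (g \<omega>) < inverse (Suc (K \<omega>))" .
    qed (use that f g \<open>g \<omega> \<notin> W (K \<omega>)\<close> in auto)
    then show "{\<omega> \<in> space M. e < \<sigma> (f i \<omega>) (g \<omega>)} \<subseteq> {\<omega> \<in> space M. \<omega> \<in> D (K \<omega>) i}" for i by force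
  qed
qed

subsection \<open>The probability space and measure-preserving maps\<close>

lemma space_Omega [simp]: "space \<Omega> = {0..1}"
  by (simp add: \<Omega>_def space_restrict_space)

interpretation Om: prob_space \<Omega>
  by standard (simp add: \<Omega>_def space_restrict_space emeasure_restrict_space)

lemma sets_Omega_iff: "A \<in> sets \<Omega> \<longleftrightarrow> A \<in> sets borel \<and> A \<subseteq> {0..1}"
  by (auto simp: \<Omega>_def sets_restrict_space_iff)

lemma borel_measurable_id_Omega: "(\<lambda>\<omega>. \<omega>) \<in> borel_measurable \<Omega>"
  unfolding \<Omega>_def by (intro measurable_restrict_space1) simp

lemma measurable_into_Omega:
  assumes "f \<in> borel_measurable \<Omega>" and "\<And>\<omega>. \<omega> \<in> space \<Omega> \<Longrightarrow> f \<omega> \<in> {0..1}"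
  shows "f \<in> measurable \<Omega> \<Omega>"
proof (rule measurableI)
  show "f -` A \<inter> space \<Omega> \<in> sets \<Omega>" if "A \<in> sets \<Omega>" for A
    using measurable_sets[OF assms(1), of A] that by (simp add: sets_Omega_iff[of A])
qed (use assms(2) in simp)

lemma mp_measurable: "mp t \<Longrightarrow> t \<in> measurable \<Omega> \<Omega>"
  by (simp add: mp_def)

lemma mp_distr: "mp t \<Longrightarrow> distr \<Omega> \<Omega> t = \<Omega>"
  by (simp add: mp_def)

lemma borel_measurable_comp_mp: "mp t \<Longrightarrow> r \<in> borel_measurable \<Omega> \<Longrightarrow> (\<lambda>\<omega>. r (t \<omega>)) \<in> borel_measurable \<Omega>"
  by (rule measurable_compose[OF mp_measurable])

lemma AE_comp_mp:
  assumes "mp t" "AE \<omega> in \<Omega>. P \<omega>"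
  shows "AE \<omega> in \<Omega>. P (t \<omega>)"
proof (rule AE_distrD[OF mp_measurable[OF assms(1)]])
  show "AE \<omega> in distr \<Omega> \<Omega> t. P \<omega>"
    using assms(2) unfolding mp_distr[OF assms(1)] .
qed

lemma measure_mp_vimage:
  assumes "mp t" "A \<in> sets \<Omega>"
  shows "measure \<Omega> (t -` A \<inter> space \<Omega>) = measure \<Omega> A"
  using measure_distr[OF mp_measurable[OF assms(1)] assms(2)] mp_distr[OF assms(1)] by simp

lemma integral_mp:
  fixes f :: "real \<Rightarrow> 'b::{banach, second_countable_topology}"
  assumes "mp t" "f \<in> borel_measurable \<Omega>"
  shows "(\<integral>\<omega>. f (t \<omega>) \<partial>\<Omega>) = (\<integral>\<omega>. f \<omega> \<partial>\<Omega>)"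
  using integral_distr[OF mp_measurable[OF assms(1)] assms(2)] mp_distr[OF assms(1)] by simp

lemma mp_comp:
  assumes "mp s" "mp t"
  shows "mp (s \<circ> t)"
proof -
  have "distr \<Omega> \<Omega> (s \<circ> t) = distr (distr \<Omega> \<Omega> t) \<Omega> s"
    using assms by (simp add: distr_distr mp_measurable)
  then show ?thesis
    using assms by (auto simp: mp_def intro: measurable_comp)
qed

definition mp_inverses :: "(real \<Rightarrow> real) \<Rightarrow> (real \<Rightarrow> real) \<Rightarrow> bool" where
  "mp_inverses t s \<longleftrightarrow> mp t \<and> mp s \<and> (AE \<omega> in \<Omega>. s (t \<omega>) = \<omega>) \<and> (AE \<omega> in \<Omega>. t (s \<omega>) = \<omega>)"

lemma mp_inversesD:
  assumes "mp_inverses t s"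
  shows "mp t" "mp s" "AE \<omega> in \<Omega>. s (t \<omega>) = \<omega>" "AE \<omega> in \<Omega>. t (s \<omega>) = \<omega>"
  using assms by (simp_all add: mp_inverses_def)

lemma mp_inverses_sym: "mp_inverses t s \<Longrightarrow> mp_inverses s t"
  by (simp add: mp_inverses_def)

lemma mp_inverses_cong:
  assumes "mp_inverses t s" "mp_inverses t' s'" "aeq t t'"
  shows "aeq s s'"
proof -
  have "mp s" by (rule mp_inversesD(2)[OF assms(1)])
  have "AE \<omega> in \<Omega>. s' (t' (s \<omega>)) = s \<omega>" "AE \<omega> in \<Omega>. t (s \<omega>) = t' (s \<omega>)"
    using AE_comp_mp[OF \<open>mp s\<close> mp_inversesD(3)[OF assms(2)]]
      AE_comp_mp[OF \<open>mp s\<close> assms(3)[unfolded aeq_def]] .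
  with mp_inversesD(4)[OF assms(1)] show ?thesis
    unfolding aeq_def by eventually_elim simp
qed

lemma mp_inverses_comp:
  assumes t: "mp_inverses t s" and t': "mp_inverses t' s'"
  shows "mp_inverses (t \<circ> t') (s' \<circ> s)"
  unfolding mp_inverses_def
proof (intro conjI mp_comp mp_inversesD[OF t] mp_inversesD[OF t'])
  note T = mp_inversesD[OF t] and T' = mp_inversesD[OF t']
  show "AE \<omega> in \<Omega>. (s' \<circ> s) ((t \<circ> t') \<omega>) = \<omega>"
    using T'(3) AE_comp_mp[OF T'(1) T(3)] by eventually_elim simp
  show "AE \<omega> in \<Omega>. (t \<circ> t') ((s' \<circ> s) \<omega>) = \<omega>"
    using T(4) AE_comp_mp[OF T(2) T'(4)] by eventually_elim simp
qed

lemma autOmega_iff: "t \<in> autOmega \<longleftrightarrow> (\<exists>s. mp_inverses t s)"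
  by (auto simp: autOmega_def mp_inverses_def)

lemma mp_inverses_tinv: "t \<in> autOmega \<Longrightarrow> mp_inverses t (tinv t)"
  using someI_ex[of "\<lambda>s. mp s \<and> (AE \<omega> in \<Omega>. s (t \<omega>) = \<omega>) \<and> (AE \<omega> in \<Omega>. t (s \<omega>) = \<omega>)"]
  by (simp add: tinv_def autOmega_def mp_inverses_def)

lemma autOmega_mp: "t \<in> autOmega \<Longrightarrow> mp t"
  by (rule mp_inversesD(1)[OF mp_inverses_tinv])

lemma mp_tinv: "t \<in> autOmega \<Longrightarrow> mp (tinv t)"
  by (rule mp_inversesD(2)[OF mp_inverses_tinv])

lemma aeq_tinvI: "mp_inverses t s \<Longrightarrow> aeq (tinv t) s"
  using mp_inverses_cong[OF mp_inverses_tinv, of t t s] by (auto simp: autOmega_iff aeq_def)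

lemma aeq_tinv_iff:
  assumes "t \<in> autOmega" "t' \<in> autOmega"
  shows "aeq (tinv t) (tinv t') \<longleftrightarrow> aeq t t'"
proof -
  note inv = assms[THEN mp_inverses_tinv]
  show ?thesis
    using mp_inverses_cong[OF inv] mp_inverses_cong[OF inv[THEN mp_inverses_sym]] by blast
qed

lemma autOmega_comp:
  assumes "t \<in> autOmega" "t' \<in> autOmega"
  shows "t \<circ> t' \<in> autOmega" "aeq (tinv (t \<circ> t')) (tinv t' \<circ> tinv t)"
  using mp_inverses_comp[OF assms[THEN mp_inverses_tinv]] aeq_tinvI by (auto simp: autOmega_iff)

subsection \<open>Classes modulo null sets\<close>

lemma aeq_refl [simp]: "aeq r r"
  by (simp add: aeq_def)

lemma aeq_sym: "aeq r s \<Longrightarrow> aeq s r"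
  by (simp add: aeq_def eq_commute)

lemma aeq_trans:
  assumes "aeq r s" "aeq s u"
  shows "aeq r u"
  using assms unfolding aeq_def by eventually_elim simp

lemma rep_aecls:
  assumes "r \<in> S"
  shows "rep (aecls S r) \<in> S" "aeq (rep (aecls S r)) r"
proof -
  have "r \<in> aecls S r" using assms by (simp add: aecls_def)
  then have "rep (aecls S r) \<in> aecls S r" unfolding rep_def by (rule someI[of "\<lambda>s. s \<in> aecls S r"])
  then show "rep (aecls S r) \<in> S" "aeq (rep (aecls S r)) r" by (auto simp: aecls_def)
qed

lemma aecls_eq_iff: "r \<in> S \<Longrightarrow> aecls S r = aecls S s \<longleftrightarrow> aeq r s"
  unfolding aecls_def using aeq_sym[of r s] aeq_trans[of _ r s] aeq_trans[of _ s r] by auto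

lemma aecls_rep:
  assumes "X \<in> aecls S ` S"
  shows "rep X \<in> S" "aecls S (rep X) = X"
proof -
  obtain r where r: "r \<in> S" "X = aecls S r" using assms by blast
  show "rep X \<in> S" "aecls S (rep X) = X"
    using rep_aecls[OF r(1)] by (simp_all add: r(2) aecls_eq_iff)
qed

definition cls_map :: "(real \<Rightarrow> 'a) set \<Rightarrow> ((real \<Rightarrow> 'a) \<Rightarrow> real \<Rightarrow> 'a) \<Rightarrow> (real \<Rightarrow> 'a) set \<Rightarrow> (real \<Rightarrow> 'a) set" where
  "cls_map S f X = aecls S (f (rep X))"

definition respects_aeq :: "(real \<Rightarrow> 'a) set \<Rightarrow> ((real \<Rightarrow> 'a) \<Rightarrow> real \<Rightarrow> 'a) \<Rightarrow> bool" where
  "respects_aeq S f \<longleftrightarrow> (\<forall>r\<in>S. f r \<in> S) \<and> (\<forall>r s. aeq r s \<longrightarrow> aeq (f r) (f s))"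

lemma cls_map_aecls:
  assumes "respects_aeq S f" "r \<in> S"
  shows "cls_map S f (aecls S r) = aecls S (f r)"
  using assms rep_aecls[OF assms(2)] by (simp add: cls_map_def respects_aeq_def aecls_eq_iff)

lemma cls_map_in_classes: "respects_aeq S f \<Longrightarrow> X \<in> aecls S ` S \<Longrightarrow> cls_map S f X \<in> aecls S ` S"
  by (simp add: cls_map_def respects_aeq_def aecls_rep(1))

lemma cls_map_eq_iff:
  "respects_aeq S f \<Longrightarrow> X \<in> aecls S ` S \<Longrightarrow> cls_map S f X = cls_map S h X \<longleftrightarrow> aeq (f (rep X)) (h (rep X))"
  by (simp add: cls_map_def respects_aeq_def aecls_eq_iff aecls_rep(1))

lemma bij_betw_cls_map:
  assumes f: "respects_aeq S f" and h: "respects_aeq S h"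
    and inv: "\<And>r. aeq (h (f r)) r" "\<And>r. aeq (f (h r)) r"
  shows "bij_betw (cls_map S f) (aecls S ` S) (aecls S ` S)"
proof (rule bij_betw_byWitness[where f' = "cls_map S h"])
  have cancel: "cls_map S h (cls_map S f X) = X"
    if "X \<in> aecls S ` S" "respects_aeq S f" "respects_aeq S h" "\<And>r. aeq (h (f r)) r" for X f h
  proof -
    have X: "rep X \<in> S" "aecls S (rep X) = X" using that(1) by (rule aecls_rep)+
    then have "cls_map S h (cls_map S f X) = aecls S (h (f (rep X)))"
      using that(2) cls_map_aecls[OF that(3)] by (simp add: cls_map_def[of S f] respects_aeq_def)
    also have "\<dots> = aecls S (rep X)" using X(1) that(2-4) by (simp add: aecls_eq_iff respects_aeq_def)
    finally show ?thesis using X(2) by simp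
  qed
  show "\<forall>X\<in>aecls S ` S. cls_map S h (cls_map S f X) = X" using cancel[OF _ f h inv(1)] by blast
  show "\<forall>X\<in>aecls S ` S. cls_map S f (cls_map S h X) = X" using cancel[OF _ h f inv(2)] by blast
  show "cls_map S f ` aecls S ` S \<subseteq> aecls S ` S" "cls_map S h ` aecls S ` S \<subseteq> aecls S ` S"
    using cls_map_in_classes[OF f] cls_map_in_classes[OF h] by blast+
qed

locale bounded_L0 =
  fixes S :: "(real \<Rightarrow> 'a::{metric_space, second_countable_topology}) set"
  assumes measurable: "r \<in> S \<Longrightarrow> r \<in> borel_measurable \<Omega>"
    and dist_le_1: "r \<in> S \<Longrightarrow> s \<in> S \<Longrightarrow> \<omega> \<in> {0..1} \<Longrightarrow> dist (r \<omega>) (s \<omega>) \<le> 1"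
begin

lemma integrable_dist: "r \<in> S \<Longrightarrow> s \<in> S \<Longrightarrow> integrable \<Omega> (\<lambda>\<omega>. dist (r \<omega>) (s \<omega>))"
  by (rule Om.integrable_const_bound[of _ 1])
    (auto intro!: dist_le_1 borel_measurable_dist measurable)

lemma dMain_aecls:
  assumes "r \<in> S" "s \<in> S"
  shows "dMain (aecls S r) (aecls S s) = (\<integral>\<omega>. dist (r \<omega>) (s \<omega>) \<partial>\<Omega>)"
  unfolding dMain_def
proof (rule integral_cong_AE)
  show "AE \<omega> in \<Omega>. dist (rep (aecls S r) \<omega>) (rep (aecls S s) \<omega>) = dist (r \<omega>) (s \<omega>)"
    using rep_aecls(2)[OF assms(1)] rep_aecls(2)[OF assms(2)] unfolding aeq_def by eventually_elim simp
qed (intro borel_measurable_dist measurable rep_aecls(1) assms)+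

sublocale Metric_space "aecls S ` S" dMain
proof
  fix X Y Z :: "(real \<Rightarrow> 'a) set"
  show "0 \<le> dMain X Y" "dMain X Y = dMain Y X" by (simp_all add: dMain_def dist_commute)
  assume X: "X \<in> aecls S ` S" and Y: "Y \<in> aecls S ` S"
  note int = integrable_dist[OF aecls_rep(1) aecls_rep(1)]
  have "dMain X Y = 0 \<longleftrightarrow> aeq (rep X) (rep Y)"
    using integral_nonneg_eq_0_iff_AE[OF int[OF X Y]] by (simp add: dMain_def aeq_def)
  also have "\<dots> \<longleftrightarrow> X = Y"
    using aecls_eq_iff[OF aecls_rep(1)[OF X], of "rep Y"] by (simp add: aecls_rep(2)[OF X] aecls_rep(2)[OF Y])
  finally show "dMain X Y = 0 \<longleftrightarrow> X = Y" .
  assume Z: "Z \<in> aecls S ` S"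
  have "dMain X Z \<le> (\<integral>\<omega>. dist (rep X \<omega>) (rep Y \<omega>) + dist (rep Y \<omega>) (rep Z \<omega>) \<partial>\<Omega>)"
    unfolding dMain_def
    by (intro integral_mono Bochner_Integration.integrable_add int X Y Z dist_triangle)
  also have "\<dots> = dMain X Y + dMain Y Z"
    unfolding dMain_def by (intro Bochner_Integration.integral_add int X Y Z)
  finally show "dMain X Z \<le> dMain X Y + dMain Y Z" .
qed

lemma dMain_aecls_tendsto_0_iff:
  assumes "\<And>i. f i \<in> S" "h \<in> S"
  shows "((\<lambda>i. dMain (aecls S (f i)) (aecls S h)) \<longlongrightarrow> 0) F \<longleftrightarrow>
    tendsto_0_in_measure \<Omega> F (\<lambda>i \<omega>. dist (f i \<omega>) (h \<omega>))"
    (is "?lhs \<longleftrightarrow> ?rhs")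
proof -
  have "?lhs \<longleftrightarrow> ((\<lambda>i. \<integral>\<omega>. dist (f i \<omega>) (h \<omega>) \<partial>\<Omega>) \<longlongrightarrow> 0) F"
    by (simp add: dMain_aecls assms)
  also have "\<dots> \<longleftrightarrow> ?rhs"
  proof
    show "((\<lambda>i. \<integral>\<omega>. dist (f i \<omega>) (h \<omega>) \<partial>\<Omega>) \<longlongrightarrow> 0) F" if ?rhs
      using that by (rule Om.integral_tendsto_0_if_in_measure)
        (use assms in \<open>auto intro: borel_measurable_integrable integrable_dist dist_le_1\<close>)
    show ?rhs if "((\<lambda>i. \<integral>\<omega>. dist (f i \<omega>) (h \<omega>) \<partial>\<Omega>) \<longlongrightarrow> 0) F"
      using that by (rule Om.tendsto_0_in_measure_if_integral) (use assms in \<open>auto intro: integrable_dist\<close>)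
  qed
  finally show ?thesis .
qed

end

lemma L0A_iff: "R \<in> L0A \<longleftrightarrow> R \<in> borel_measurable \<Omega> \<and> (\<forall>\<omega>\<in>{0..1}. 0 \<le> R \<omega> \<and> R \<omega> \<le> 1)"
  by (simp add: L0A_def)

interpretation Aux: bounded_L0 L0A
proof
  fix R Q :: "real \<Rightarrow> real" and \<omega> :: real
  assume "R \<in> L0A" "Q \<in> L0A" "\<omega> \<in> {0..1}"
  then have "0 \<le> R \<omega>" "R \<omega> \<le> 1" "0 \<le> Q \<omega>" "Q \<omega> \<le> 1" by (auto simp: L0A_iff)
  then show "dist (R \<omega>) (Q \<omega>) \<le> 1" by (simp add: dist_real_def)
qed (simp add: L0A_iff)

lemma metric_structureD:
  fixes M :: "('f, 'p, 'm::metric_space) mstruct"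
  assumes "metric_structure M"
  shows "dist (x::'m) y \<le> 1" "ucont_list (fun_ar M f) (fun_int M f)" "ucont_list (pred_ar M p) (pred_int M p)"
    "length xs = pred_ar M p \<Longrightarrow> pred_int M p xs \<in> {0..1}"
  using assms by (auto simp: metric_structure_def)

lemma bounded_L0_L0M:
  fixes M :: "('f, 'p, 'm::polish_space) mstruct"
  assumes "metric_structure M"
  shows "bounded_L0 (L0M :: (real \<Rightarrow> 'm) set)"
  by standard (simp_all add: L0M_def metric_structureD(1)[OF assms])

lemma dAux_eq_dMain: "dAux = dMain"
  by (simp add: fun_eq_iff dAux_def dMain_def dist_real_def)

lemma ident_L0A: "(\<lambda>\<omega>. \<omega>) \<in> L0A"
  by (simp add: L0A_iff borel_measurable_id_Omega)

lemma aecls_MainC: "r \<in> borel_measurable \<Omega> \<Longrightarrow> aecls L0M r \<in> MainC"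
  by (simp add: MainC_def L0M_def)

lemma aecls_AuxC: "R \<in> L0A \<Longrightarrow> aecls L0A R \<in> AuxC"
  by (simp add: AuxC_def)

lemma MainC_rep: "X \<in> MainC \<Longrightarrow> rep X \<in> borel_measurable \<Omega>" "X \<in> MainC \<Longrightarrow> aecls L0M (rep X) = X"
  using aecls_rep[of X L0M] by (auto simp: MainC_def L0M_def)

lemma AuxC_rep: "X \<in> AuxC \<Longrightarrow> rep X \<in> L0A" "X \<in> AuxC \<Longrightarrow> aecls L0A (rep X) = X"
  using aecls_rep[of X L0A] by (auto simp: AuxC_def)

lemma EA_aecls:
  assumes "R \<in> L0A"
  shows "EA (aecls L0A R) = (\<integral>\<omega>. R \<omega> \<partial>\<Omega>)"
  unfolding EA_def using rep_aecls[OF assms] assms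
  by (intro integral_cong_AE) (simp_all add: aeq_def Aux.measurable)

lemma L0A_comp_mp: "mp t \<Longrightarrow> R \<in> L0A \<Longrightarrow> (\<lambda>\<omega>. R (t \<omega>)) \<in> L0A"
  using measurable_space[OF mp_measurable, of t] by (auto simp: L0A_iff borel_measurable_comp_mp)

subsection \<open>Formulas\<close>

lemma ucont_list_tendsto_0:
  fixes u v :: "'k \<Rightarrow> 'i \<Rightarrow> 'a::metric_space"
  assumes h: "ucont_list (length ks) h" and conv: "\<And>k. k \<in> set ks \<Longrightarrow> ((\<lambda>i. dist (u k i) (v k i)) \<longlongrightarrow> 0) F"
  shows "((\<lambda>i. dist (h (map (\<lambda>k. u k i) ks)) (h (map (\<lambda>k. v k i) ks))) \<longlongrightarrow> 0) F"
proof (rule tendstoI)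
  fix e :: real assume "e > 0"
  then obtain d where d: "d > 0" "\<And>xs ys. \<lbrakk>length xs = length ks; length ys = length ks;
      \<forall>n<length ks. dist (xs ! n) (ys ! n) < d\<rbrakk> \<Longrightarrow> dist (h xs) (h ys) < e"
    using h unfolding ucont_list_def by meson
  have "\<forall>\<^sub>F i in F. \<forall>k\<in>set ks. dist (u k i) (v k i) < d"
    using order_tendstoD(2)[OF conv d(1)] by (intro eventually_ball_finite) auto
  then show "\<forall>\<^sub>F i in F. dist (dist (h (map (\<lambda>k. u k i) ks)) (h (map (\<lambda>k. v k i) ks))) 0 < e"
    by eventually_elim (use d(2) in simp)
qed

lemma ucont_list_tendsto:
  assumes "ucont_list (length ks) h" "\<And>k. k \<in> set ks \<Longrightarrow> (u k \<longlongrightarrow> l k) F"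
  shows "((\<lambda>i. h (map (\<lambda>k. u k i) ks)) \<longlongrightarrow> h (map l ks)) F"
  using ucont_list_tendsto_0[OF assms(1), of u "\<lambda>k _. l k"] assms(2)
  by (simp add: tendsto_dist_iff[symmetric])

lemma uniformly_continuous_on_ucont_list:
  fixes fs :: "('a::metric_space \<Rightarrow> 'b::metric_space) list"
  assumes "ucont_list (length fs) h" "\<And>f. f \<in> set fs \<Longrightarrow> uniformly_continuous_on S f"
  shows "uniformly_continuous_on S (\<lambda>x. h (map (\<lambda>f. f x) fs))"
  unfolding uniformly_continuous_on_sequentially
proof (intro allI impI)
  fix x y assume "(\<forall>n. x n \<in> S) \<and> (\<forall>n. y n \<in> S) \<and> (\<lambda>n. dist (x n) (y n)) \<longlonglongrightarrow> 0"
  then show "(\<lambda>n. dist (h (map (\<lambda>f. f (x n)) fs)) (h (map (\<lambda>f. f (y n)) fs))) \<longlonglongrightarrow> 0"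
    using assms(2) unfolding uniformly_continuous_on_sequentially
    by (intro ucont_list_tendsto_0[where u = "\<lambda>f n. f (x n)" and v = "\<lambda>f n. f (y n)", OF assms(1)]) blast
qed

lemma abs_SUP_diff_le:
  fixes f h :: "'a \<Rightarrow> real"
  assumes "bdd_above (range f)" "bdd_above (range h)" "\<And>a. \<bar>f a - h a\<bar> \<le> e"
  shows "\<bar>(SUP a. f a) - (SUP a. h a)\<bar> \<le> e"
proof -
  have "(SUP a. u a) \<le> (SUP a. v a) + e" if "bdd_above (range v)" "\<And>a. u a \<le> v a + e" for u v :: "'a \<Rightarrow> real"
  proof (rule cSUP_least)
    show "u a \<le> (SUP a. v a) + e" for a
      using that(2)[of a] cSUP_upper[OF UNIV_I that(1), of a] by simp
  qed simp
  note SUP_le = this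
  have "f a \<le> h a + e" "h a \<le> f a + e" for a using assms(3)[of a] by (simp_all add: abs_le_iff)
  then show ?thesis using SUP_le[of h f] SUP_le[of f h] assms(1,2)
    by (simp add: abs_le_iff diff_le_eq add.commute)
qed

lemma uniformly_continuous_on_SUP_fun_upd:
  fixes f :: "('k::countable \<Rightarrow> 'a::metric_space) \<Rightarrow> real"
  assumes f: "uniformly_continuous_on UNIV f" and bdd: "bdd_above (range f)"
  shows "uniformly_continuous_on UNIV (\<lambda>\<rho>. SUP a. f (\<rho>(k := a)))"
  unfolding uniformly_continuous_on_def
proof (intro allI impI)
  fix e :: real assume "e > 0"
  then obtain d where d: "d > 0" "\<And>v w. dist w v < d \<Longrightarrow> dist (f w) (f v) < e / 2"
    using f[unfolded uniformly_continuous_on_def, rule_format, of "e / 2"] by auto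
  have "dist (SUP a. f (w(k := a))) (SUP a. f (v(k := a))) < e" if "dist w v < d" for v w
  proof -
    have "\<bar>(SUP a. f (w(k := a))) - (SUP a. f (v(k := a)))\<bar> \<le> e / 2"
    proof (rule abs_SUP_diff_le)
      show "bdd_above (range (\<lambda>a. f (w(k := a))))" "bdd_above (range (\<lambda>a. f (v(k := a))))"
        by (rule bdd_above_mono[OF bdd], auto)+
      show "\<bar>f (w(k := a)) - f (v(k := a))\<bar> \<le> e / 2" for a
        using d(2)[OF le_less_trans[OF dist_fun_upd_le that]] by (simp add: dist_real_def less_imp_le)
    qed
    then show ?thesis using \<open>e > 0\<close> by (simp add: dist_real_def)
  qed
  then show "\<exists>d>0. \<forall>v\<in>UNIV. \<forall>w\<in>UNIV. dist w v < d \<longrightarrow> dist (SUP a. f (w(k := a))) (SUP a. f (v(k := a))) < e"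
    using d(1) by blast
qed

lemma conn_ok_ucont_list_clamp:
  assumes "conn_ok n c"
  shows "ucont_list n (\<lambda>xs. c (map (clamp 0 1) xs))"
  unfolding ucont_list_def
proof (intro allI impI)
  fix e :: real assume "e > 0"
  then obtain d where d: "d > 0" "\<And>xs ys. \<lbrakk>length xs = n; length ys = n; set xs \<subseteq> {0..1}; set ys \<subseteq> {0..1};
      \<forall>i<n. \<bar>xs ! i - ys ! i\<bar> < d\<rbrakk> \<Longrightarrow> \<bar>c xs - c ys\<bar> < e"
    using assms unfolding conn_ok_def by meson
  have range: "set (map (clamp 0 1) xs) \<subseteq> {0..1}" for xs :: "real list"
    using clamp_in_interval[of 0 "1::real"] by auto
  show "\<exists>d>0. \<forall>xs ys. length xs = n \<and> length ys = n \<and> (\<forall>i<n. dist (xs ! i) (ys ! i) < d) \<longrightarrow>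
      dist (c (map (clamp 0 1) xs)) (c (map (clamp 0 1) ys)) < e"
  proof (intro exI[of _ d] conjI allI impI)
    fix xs ys :: "real list" assume "length xs = n \<and> length ys = n \<and> (\<forall>i<n. dist (xs ! i) (ys ! i) < d)"
    moreover from this have "\<forall>i<n. \<bar>map (clamp 0 1) xs ! i - map (clamp 0 1) ys ! i\<bar> < d"
      using le_less_trans[OF dist_clamps_le_dist_args[of 0 "1::real"]] by (auto simp: dist_real_def)
    ultimately show "dist (c (map (clamp 0 1) xs)) (c (map (clamp 0 1) ys)) < e"
      using d(2)[of "map (clamp 0 1) xs" "map (clamp 0 1) ys"] range by (simp add: dist_real_def)
  qed (rule d(1))
qed

lemma map_clamp_unit_interval: "set xs \<subseteq> {0..1} \<Longrightarrow> map (clamp 0 1) xs = (xs :: real list)"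
  by (auto intro!: map_idI simp: subset_iff)

lemma conn_ok_unit_interval: "conn_ok (length xs) c \<Longrightarrow> set xs \<subseteq> {0..1} \<Longrightarrow> c xs \<in> {0..1}"
  by (simp add: conn_ok_def)

lemma uniformly_continuous_teval:
  fixes M :: "('f, 'p, 'm::metric_space) mstruct"
  assumes "metric_structure M" "wf_trm M t"
  shows "uniformly_continuous_on UNIV (\<lambda>\<rho>. teval M \<rho> t)"
  using assms(2)
proof (induction t)
  case (Var n)
  show ?case using uniformly_continuous_on_coordinate[of UNIV n] by simp
next
  case (Fn f ts)
  then have "uniformly_continuous_on UNIV (\<lambda>\<rho>. fun_int M f (map (\<lambda>h. h \<rho>) (map (\<lambda>t \<rho>. teval M \<rho> t) ts)))"
    using metric_structureD(2)[OF assms(1), of f] by (intro uniformly_continuous_on_ucont_list) auto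
  then show ?case by (simp add: comp_def)
qed

lemma feval_unit_interval:
  fixes M :: "('f, 'p, 'm::metric_space) mstruct"
  assumes "metric_structure M" "wf_fml M \<phi>"
  shows "feval M \<rho> \<phi> \<in> {0..1}"
  using assms(2)
proof (induction \<phi> arbitrary: \<rho>)
  case (Atom p ts)
  then show ?case using metric_structureD(4)[OF assms(1), of "map (teval M \<rho>) ts" p] by simp
next
  case (Dst t u)
  then show ?case using metric_structureD(1)[OF assms(1)] by simp
next
  case (Conn c fs)
  then show ?case using conn_ok_unit_interval[of "map (feval M \<rho>) fs" c] by (simp add: image_subset_iff)
next
  case (Sup x \<phi>)
  then have "range (\<lambda>a. feval M (\<rho>(x := a)) \<phi>) \<subseteq> {0..1}" by auto
  moreover from this have "bdd_above (range (\<lambda>a. feval M (\<rho>(x := a)) \<phi>))"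
    by (rule bdd_above_mono[rotated]) simp
  ultimately show ?case using closed_subset_contains_Sup[OF closed_atLeastAtMost] by simp
next
  case (Inf x \<phi>)
  then have "range (\<lambda>a. feval M (\<rho>(x := a)) \<phi>) \<subseteq> {0..1}" by auto
  moreover from this have "bdd_below (range (\<lambda>a. feval M (\<rho>(x := a)) \<phi>))"
    by (rule bdd_below_mono[rotated]) simp
  ultimately show ?case using closed_subset_contains_Inf[OF closed_atLeastAtMost] by simp
qed

lemma uniformly_continuous_feval:
  fixes M :: "('f, 'p, 'm::metric_space) mstruct"
  assumes "metric_structure M" "wf_fml M \<phi>"
  shows "uniformly_continuous_on UNIV (\<lambda>\<rho>. feval M \<rho> \<phi>)"
  using assms(2)
proof (induction \<phi>)
  case (Atom p ts)
  then have "uniformly_continuous_on UNIV (\<lambda>\<rho>. pred_int M p (map (\<lambda>h. h \<rho>) (map (\<lambda>t \<rho>. teval M \<rho> t) ts)))"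
    using metric_structureD(3)[OF assms(1), of p] uniformly_continuous_teval[OF assms(1)]
    by (intro uniformly_continuous_on_ucont_list) auto
  then show ?case by (simp add: comp_def)
next
  case (Dst t u)
  then show ?case by (auto intro!: uniformly_continuous_on_dist uniformly_continuous_teval[OF assms(1)])
next
  case (Conn c fs)
  let ?c = "\<lambda>xs. c (map (clamp 0 1) xs)"
  have "map (clamp 0 1) (map (feval M \<rho>) fs) = map (feval M \<rho>) fs" for \<rho>
    using feval_unit_interval[OF assms(1)] Conn.prems
    by (intro map_clamp_unit_interval) (auto simp: image_subset_iff)
  moreover have "uniformly_continuous_on UNIV (\<lambda>\<rho>. ?c (map (\<lambda>h. h \<rho>) (map (\<lambda>f \<rho>. feval M \<rho> f) fs)))"
    using Conn conn_ok_ucont_list_clamp[of "length fs" c] by (intro uniformly_continuous_on_ucont_list) auto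
  ultimately show ?case by (simp add: comp_def cong: map_cong)
next
  case (Sup x \<phi>)
  have "range (\<lambda>\<rho>. feval M \<rho> \<phi>) \<subseteq> {0..1}" using feval_unit_interval[OF assms(1)] Sup.prems by auto
  then have "bdd_above (range (\<lambda>\<rho>. feval M \<rho> \<phi>))" by (rule bdd_above_mono[rotated]) simp
  with Sup have "uniformly_continuous_on UNIV (\<lambda>\<rho>. SUP a. feval M (\<rho>(x := a)) \<phi>)"
    by (intro uniformly_continuous_on_SUP_fun_upd) auto
  then show ?case by simp
next
  case (Inf x \<phi>)
  have "range (\<lambda>\<rho>. - feval M \<rho> \<phi>) \<subseteq> {-1..0}" using feval_unit_interval[OF assms(1)] Inf.prems by auto
  then have "bdd_above (range (\<lambda>\<rho>. - feval M \<rho> \<phi>))" by (rule bdd_above_mono[rotated]) simp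
  then have "uniformly_continuous_on UNIV (\<lambda>\<rho>. - (SUP a. - feval M (\<rho>(x := a)) \<phi>))"
    using Inf by (intro uniformly_continuous_on_minus uniformly_continuous_on_SUP_fun_upd) auto
  then show ?case by (simp add: Inf_real_def image_image)
qed

lemma feval_L0A:
  fixes M :: "('f, 'p, 'm::polish_space) mstruct"
  assumes "metric_structure M" "wf_fml M \<phi>" "\<And>i. r i \<in> borel_measurable \<Omega>"
  shows "(\<lambda>\<omega>. feval M (\<lambda>i. r i \<omega>) \<phi>) \<in> L0A"
proof -
  have "(\<lambda>\<omega> i. r i \<omega>) \<in> borel_measurable \<Omega>"
    by (rule measurable_coordinatewise_then_product) (rule assms(3))
  moreover have "(\<lambda>\<rho>. feval M \<rho> \<phi>) \<in> borel_measurable borel"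
    by (intro borel_measurable_continuous_onI uniformly_continuous_imp_continuous
        uniformly_continuous_feval assms)
  ultimately have "(\<lambda>\<omega>. feval M (\<lambda>i. r i \<omega>) \<phi>) \<in> borel_measurable \<Omega>" by (rule measurable_compose)
  then show ?thesis using feval_unit_interval[OF assms(1,2)] by (simp add: L0A_iff)
qed

lemma borel_measurable_ucont_list:
  fixes h :: "'a::{metric_space, second_countable_topology} list \<Rightarrow> 'b::metric_space"
  assumes h: "ucont_list (length rs) h" and rs: "\<And>r. r \<in> set rs \<Longrightarrow> r \<in> borel_measurable N"
  shows "(\<lambda>\<omega>. h (map (\<lambda>r. r \<omega>) rs)) \<in> borel_measurable N"
proof -
  let ?coord = "map (\<lambda>i \<rho>. \<rho> i) [0..<length rs] :: ((nat \<Rightarrow> 'a) \<Rightarrow> 'a) list"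
  define v where "v \<omega> i = (if i < length rs then (rs ! i) \<omega> else undefined)" for \<omega> and i :: nat
  have "v \<in> borel_measurable N"
  proof (rule measurable_coordinatewise_then_product)
    show "(\<lambda>\<omega>. v \<omega> i) \<in> borel_measurable N" for i
      using rs by (cases "i < length rs") (simp_all add: v_def)
  qed
  moreover have "uniformly_continuous_on UNIV (\<lambda>\<rho>. h (map (\<lambda>f. f \<rho>) ?coord))"
    using h by (intro uniformly_continuous_on_ucont_list) (auto intro: uniformly_continuous_on_coordinate)
  then have "(\<lambda>\<rho>. h (map (\<lambda>f. f \<rho>) ?coord)) \<in> borel_measurable borel"
    by (intro borel_measurable_continuous_onI uniformly_continuous_imp_continuous)
  ultimately have "(\<lambda>\<omega>. h (map (\<lambda>f. f (v \<omega>)) ?coord)) \<in> borel_measurable N" by (rule measurable_compose)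
  moreover have "map (\<lambda>f. f (v \<omega>)) ?coord = map (\<lambda>r. r \<omega>) rs" for \<omega>
    by (rule nth_equalityI) (simp_all add: v_def)
  ultimately show ?thesis by simp
qed

lemma conn_L0A:
  assumes c: "conn_ok (length Rs) c" and Rs: "set Rs \<subseteq> L0A"
  shows "(\<lambda>\<omega>. c (map (\<lambda>R. R \<omega>) Rs)) \<in> L0A"
proof -
  have unit: "set (map (\<lambda>R. R \<omega>) Rs) \<subseteq> {0..1}" if "\<omega> \<in> {0..1}" for \<omega>
    using Rs that by (auto simp: L0A_iff)
  have "(\<lambda>\<omega>. c (map (clamp 0 1) (map (\<lambda>R. R \<omega>) Rs))) \<in> borel_measurable \<Omega>"
    using Rs Aux.measurable by (intro borel_measurable_ucont_list conn_ok_ucont_list_clamp c) auto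
  then have "(\<lambda>\<omega>. c (map (\<lambda>R. R \<omega>) Rs)) \<in> borel_measurable \<Omega>"
    by (rule measurable_cong[THEN iffD1, rotated]) (simp only: space_Omega map_clamp_unit_interval[OF unit])
  then show ?thesis using conn_ok_unit_interval[OF _ unit, of _ c] c by (simp add: L0A_iff)
qed

lemma teval_aut:
  assumes "g \<in> autM M" "wf_trm M t"
  shows "teval M (\<lambda>i. g (\<rho> i)) t = g (teval M \<rho> t)"
  using assms(2)
proof (induction t)
  case (Fn f ts)
  then have "map (teval M (\<lambda>i. g (\<rho> i))) ts = map g (map (teval M \<rho>) ts)" by simp
  then show ?case using assms(1) Fn.prems by (simp add: autM_def del: map_map map_eq_conv)
qed simp

lemma range_fun_upd_surj:
  assumes "surj g"
  shows "range (\<lambda>a. F ((\<lambda>i. g (\<rho> i))(x := a))) = range (\<lambda>a. F (\<lambda>i. g ((\<rho>(x := a)) i)))"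
proof -
  have "(\<lambda>i. g (\<rho> i))(x := g a) = (\<lambda>i. g ((\<rho>(x := a)) i))" for a by auto
  then have "range (\<lambda>a. F (\<lambda>i. g ((\<rho>(x := a)) i))) = (\<lambda>a. F ((\<lambda>i. g (\<rho> i))(x := a))) ` range g"
    unfolding image_image by metis
  then show ?thesis using assms by simp
qed

lemma feval_aut:
  assumes g: "g \<in> autM M" and "wf_fml M \<phi>"
  shows "feval M (\<lambda>i. g (\<rho> i)) \<phi> = feval M \<rho> \<phi>"
  using assms(2)
proof (induction \<phi> arbitrary: \<rho>)
  case (Atom p ts)
  then have "map (teval M (\<lambda>i. g (\<rho> i))) ts = map g (map (teval M \<rho>) ts)"
    by (simp add: teval_aut[OF g])
  then show ?case using g Atom.prems by (simp add: autM_def del: map_map map_eq_conv)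
next
  case (Dst t u)
  then show ?case using g by (simp add: teval_aut[OF g]) (simp add: autM_def)
next
  case (Conn c fs)
  then have "map (feval M (\<lambda>i. g (\<rho> i))) fs = map (feval M \<rho>) fs" by simp
  then show ?case by (simp del: map_eq_conv)
next
  case (Sup x \<phi>)
  have "surj g" using g by (simp add: autM_def bij_is_surj)
  moreover have "feval M (\<lambda>i. g ((\<rho>(x := a)) i)) \<phi> = feval M (\<rho>(x := a)) \<phi>" for a
    by (rule Sup.IH) (use Sup.prems in simp)
  ultimately show ?case by (simp only: feval.simps range_fun_upd_surj[where F = "\<lambda>\<rho>. feval M \<rho> \<phi>"])
next
  case (Inf x \<phi>)
  have "surj g" using g by (simp add: autM_def bij_is_surj)
  moreover have "feval M (\<lambda>i. g ((\<rho>(x := a)) i)) \<phi> = feval M (\<rho>(x := a)) \<phi>" for a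
    by (rule Inf.IH) (use Inf.prems in simp)
  ultimately show ?case by (simp only: feval.simps range_fun_upd_surj[where F = "\<lambda>\<rho>. feval M \<rho> \<phi>"])
qed

subsection \<open>The action of the wreath product\<close>

definition random_isometries :: "(real \<Rightarrow> 'a::metric_space \<Rightarrow> 'a) set" where
  "random_isometries = {g. (\<forall>\<omega>\<in>{0..1}. g \<omega> \<in> isometries \<and> surj (g \<omega>)) \<and>
     (\<forall>x. (\<lambda>\<omega>. g \<omega> x) \<in> borel_measurable \<Omega>)}"

lemma random_isometriesD:
  assumes "g \<in> random_isometries"
  shows "\<omega> \<in> {0..1} \<Longrightarrow> g \<omega> \<in> isometries" "\<omega> \<in> {0..1} \<Longrightarrow> surj (g \<omega>)" "(\<lambda>\<omega>. g \<omega> x) \<in> borel_measurable \<Omega>"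
  using assms by (simp_all add: random_isometries_def)

lemma id_random_isometries: "(\<lambda>_ x. x) \<in> random_isometries"
  by (simp add: random_isometries_def id_isometry)

lemma autM_isometry: "g \<in> autM M \<Longrightarrow> g \<in> isometries"
  by (simp add: autM_def isometries_def)

lemma L0G_random_isometries: "g \<in> L0G M \<Longrightarrow> g \<in> random_isometries"
  by (auto simp: random_isometries_def L0G_def autM_isometry autM_def bij_is_surj
      intro: measurable_product_then_coordinatewise)

definition wr_fun :: "(real \<Rightarrow> 'a \<Rightarrow> 'a) \<times> (real \<Rightarrow> real) \<Rightarrow> (real \<Rightarrow> 'a) \<Rightarrow> real \<Rightarrow> 'a" where
  "wr_fun a r = (\<lambda>\<omega>. fst a \<omega> (r (tinv (snd a) \<omega>)))"

definition wr_fun_inv :: "(real \<Rightarrow> 'a \<Rightarrow> 'a) \<times> (real \<Rightarrow> real) \<Rightarrow> (real \<Rightarrow> 'a) \<Rightarrow> real \<Rightarrow> 'a" where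
  "wr_fun_inv a r = (\<lambda>\<omega>. inv (fst a (snd a \<omega>)) (r (snd a \<omega>)))"

lemma wr_act_eq_cls_map:
  "wr_act a = (cls_map L0M (wr_fun a), cls_map L0A (wr_fun (\<lambda>_ x. x, snd a)))"
  by (simp add: wr_act_def cls_map_def[abs_def] wr_fun_def)

lemma wr_fun_cong:
  assumes "aeq g g'" "aeq (tinv t) (tinv t')"
  shows "aeq (wr_fun (g, t) r) (wr_fun (g', t') r)"
  using assms unfolding aeq_def by eventually_elim (simp add: wr_fun_def)

lemma wr_fun_mult:
  assumes "snd a \<in> autOmega" "snd b \<in> autOmega"
  shows "aeq (wr_fun (wr_mult a b) r) (wr_fun a (wr_fun b r))"
  using autOmega_comp(2)[OF assms] unfolding aeq_def
  by eventually_elim (simp add: wr_fun_def wr_mult_def)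

lemma borel_measurable_wr_fun:
  fixes g :: "real \<Rightarrow> 'a::polish_space \<Rightarrow> 'a"
  assumes "g \<in> random_isometries" "t \<in> autOmega" "r \<in> borel_measurable \<Omega>"
  shows "wr_fun (g, t) r \<in> borel_measurable \<Omega>"
  unfolding wr_fun_def fst_conv snd_conv
  by (rule borel_measurable_isometry_apply)
    (use assms in \<open>auto simp: random_isometriesD intro: borel_measurable_comp_mp mp_tinv\<close>)

lemma borel_measurable_wr_fun_inv:
  fixes g :: "real \<Rightarrow> 'a::polish_space \<Rightarrow> 'a"
  assumes "g \<in> random_isometries" "t \<in> autOmega" "r \<in> borel_measurable \<Omega>"
  shows "wr_fun_inv (g, t) r \<in> borel_measurable \<Omega>"
proof -
  have "(\<lambda>\<omega>. inv (g \<omega>) (r \<omega>)) \<in> borel_measurable \<Omega>"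
    by (rule borel_measurable_isometry_inv_apply) (use assms in \<open>auto simp: random_isometriesD\<close>)
  then show ?thesis
    unfolding wr_fun_inv_def fst_conv snd_conv
    by (rule borel_measurable_comp_mp[OF autOmega_mp[OF assms(2)]])
qed

locale wr_action = bounded_L0 S
  for S :: "(real \<Rightarrow> 'a::{metric_space, second_countable_topology}) set" +
  fixes g :: "real \<Rightarrow> 'a \<Rightarrow> 'a" and t :: "real \<Rightarrow> real"
  assumes random_isometries: "g \<in> random_isometries" and autOmega: "t \<in> autOmega"
    and wr_fun_closed: "r \<in> S \<Longrightarrow> wr_fun (g, t) r \<in> S"
    and wr_fun_inv_closed: "r \<in> S \<Longrightarrow> wr_fun_inv (g, t) r \<in> S"
begin

lemma respects_aeq_wr_fun: "respects_aeq S (wr_fun (g, t))"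
proof -
  have "aeq (wr_fun (g, t) r) (wr_fun (g, t) s)" if "aeq r s" for r s
    using AE_comp_mp[OF mp_tinv[OF autOmega] that[unfolded aeq_def]]
    unfolding aeq_def by eventually_elim (simp add: wr_fun_def)
  then show ?thesis by (simp add: respects_aeq_def wr_fun_closed)
qed

lemma respects_aeq_wr_fun_inv: "respects_aeq S (wr_fun_inv (g, t))"
proof -
  have "aeq (wr_fun_inv (g, t) r) (wr_fun_inv (g, t) s)" if "aeq r s" for r s
    using AE_comp_mp[OF autOmega_mp[OF autOmega] that[unfolded aeq_def]]
    unfolding aeq_def by eventually_elim (simp add: wr_fun_inv_def)
  then show ?thesis by (simp add: respects_aeq_def wr_fun_inv_closed)
qed

lemma wr_fun_inv_wr_fun: "aeq (wr_fun_inv (g, t) (wr_fun (g, t) r)) r"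
  unfolding aeq_def using mp_inversesD(3)[OF mp_inverses_tinv[OF autOmega]] AE_space
proof eventually_elim
  case (elim \<omega>)
  then have "t \<omega> \<in> {0..1}" using measurable_space[OF mp_measurable[OF autOmega_mp[OF autOmega]]] by simp
  then show ?case
    using inv_isometry(2)[OF random_isometriesD(1,2)[OF random_isometries]] elim(1)
    by (simp add: wr_fun_def wr_fun_inv_def)
qed

lemma wr_fun_wr_fun_inv: "aeq (wr_fun (g, t) (wr_fun_inv (g, t) r)) r"
  unfolding aeq_def using mp_inversesD(4)[OF mp_inverses_tinv[OF autOmega]] AE_space
proof eventually_elim
  case (elim \<omega>)
  then show ?case
    using inv_isometry(1)[OF random_isometriesD(1,2)[OF random_isometries]]
    by (simp add: wr_fun_def wr_fun_inv_def)
qed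

lemma cls_map_wr_fun_aecls: "r \<in> S \<Longrightarrow> cls_map S (wr_fun (g, t)) (aecls S r) = aecls S (wr_fun (g, t) r)"
  by (rule cls_map_aecls[OF respects_aeq_wr_fun])

lemma AE_rep_cls_map_wr_fun:
  assumes "X \<in> aecls S ` S"
  shows "AE \<omega> in \<Omega>. rep (cls_map S (wr_fun (g, t)) X) \<omega> = wr_fun (g, t) (rep X) \<omega>"
  using rep_aecls(2)[OF wr_fun_closed[OF aecls_rep(1)[OF assms]]] by (simp add: cls_map_def aeq_def)

lemma bij_betw_cls_map_wr_fun: "bij_betw (cls_map S (wr_fun (g, t))) (aecls S ` S) (aecls S ` S)"
  by (rule bij_betw_cls_map[OF respects_aeq_wr_fun respects_aeq_wr_fun_inv wr_fun_inv_wr_fun wr_fun_wr_fun_inv])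

lemma dMain_cls_map_wr_fun:
  assumes "X \<in> aecls S ` S" "Y \<in> aecls S ` S"
  shows "dMain (cls_map S (wr_fun (g, t)) X) (cls_map S (wr_fun (g, t)) Y) = dMain X Y"
proof -
  note reps = aecls_rep(1)[OF assms(1)] aecls_rep(1)[OF assms(2)]
  have "dMain (cls_map S (wr_fun (g, t)) X) (cls_map S (wr_fun (g, t)) Y)
      = (\<integral>\<omega>. dist (wr_fun (g, t) (rep X) \<omega>) (wr_fun (g, t) (rep Y) \<omega>) \<partial>\<Omega>)"
    unfolding cls_map_def by (intro dMain_aecls wr_fun_closed reps)
  also have "\<dots> = (\<integral>\<omega>. dist (rep X (tinv t \<omega>)) (rep Y (tinv t \<omega>)) \<partial>\<Omega>)"
    using dist_isometry[OF random_isometriesD(1)[OF random_isometries]]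
    by (intro Bochner_Integration.integral_cong) (simp_all add: wr_fun_def)
  also have "\<dots> = dMain X Y"
    unfolding dMain_def
    by (rule integral_mp[OF mp_tinv[OF autOmega], where f = "\<lambda>\<omega>. dist (rep X \<omega>) (rep Y \<omega>)"])
      (intro borel_measurable_dist measurable reps)
  finally show ?thesis .
qed

end

lemma cls_map_wr_fun_mult:
  assumes "wr_action S g t" "wr_action S g' t'" and X: "X \<in> aecls S ` S"
  shows "cls_map S (wr_fun (wr_mult (g, t) (g', t'))) X
    = cls_map S (wr_fun (g, t)) (cls_map S (wr_fun (g', t')) X)"
proof -
  interpret a: wr_action S g t by fact
  interpret b: wr_action S g' t' by fact
  note closed = b.wr_fun_closed[OF aecls_rep(1)[OF X]]
  have "cls_map S (wr_fun (g, t)) (cls_map S (wr_fun (g', t')) X)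
      = aecls S (wr_fun (g, t) (wr_fun (g', t') (rep X)))"
    using a.cls_map_wr_fun_aecls[OF closed] by (simp add: cls_map_def[of S "wr_fun (g', t')"])
  also have "\<dots> = aecls S (wr_fun (wr_mult (g, t) (g', t')) (rep X))"
    using wr_fun_mult[of "(g, t)" "(g', t')" "rep X"] a.autOmega b.autOmega
    by (subst aecls_eq_iff[OF a.wr_fun_closed[OF closed]]) (simp add: aeq_sym)
  finally show ?thesis by (simp add: cls_map_def)
qed

lemma wr_action_L0M:
  fixes M :: "('f, 'p, 'm::polish_space) mstruct"
  assumes "metric_structure M" "g \<in> L0G M" "t \<in> autOmega"
  shows "wr_action L0M g t"
proof -
  interpret bounded_L0 "L0M :: (real \<Rightarrow> 'm) set" by (rule bounded_L0_L0M[OF assms(1)])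
  show ?thesis
    by standard (use L0G_random_isometries[OF assms(2)] assms(3) in
        \<open>simp_all add: L0M_def borel_measurable_wr_fun borel_measurable_wr_fun_inv\<close>)
qed

lemma wr_action_L0A: "t \<in> autOmega \<Longrightarrow> wr_action L0A (\<lambda>_ x. x) t"
proof (standard, rule id_random_isometries)
  fix R assume t: "t \<in> autOmega" and R: "R \<in> L0A"
  show "wr_fun (\<lambda>_ x. x, t) R \<in> L0A"
    using L0A_comp_mp[OF mp_tinv[OF t] R] by (simp add: wr_fun_def)
  show "wr_fun_inv (\<lambda>_ x. x, t) R \<in> L0A"
    using L0A_comp_mp[OF autOmega_mp[OF t] R]
    by (simp add: wr_fun_inv_def id_def[symmetric])
qed

lemma snd_wr_act_aecls:
  assumes "snd a \<in> autOmega" "R \<in> L0A"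
  shows "snd (wr_act a) (aecls L0A R) = aecls L0A (\<lambda>\<omega>. R (tinv (snd a) \<omega>))"
  using wr_action.cls_map_wr_fun_aecls[OF wr_action_L0A[OF assms(1)] assms(2)]
  by (simp add: wr_act_eq_cls_map wr_fun_def)

lemma wr_act_semR:
  fixes M :: "('f, 'p, 'm::polish_space) mstruct"
  assumes ms: "metric_structure M" and g: "g \<in> L0G M" and t: "t \<in> autOmega"
    and wf: "wf_fml M \<phi>" and \<rho>: "\<And>i. \<rho> i \<in> MainC"
  shows "snd (wr_act (g, t)) (semR M \<phi> \<rho>) = semR M \<phi> (fst (wr_act (g, t)) \<circ> \<rho>)"
proof -
  interpret wr_action L0M g t by (rule wr_action_L0M[OF ms g t])
  have "AE \<omega> in \<Omega>. \<forall>i. rep (fst (wr_act (g, t)) (\<rho> i)) \<omega> = g \<omega> (rep (\<rho> i) (tinv t \<omega>))"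
    unfolding AE_all_countable wr_act_eq_cls_map
    using AE_rep_cls_map_wr_fun \<rho> by (simp add: MainC_def wr_fun_def)
  then have "AE \<omega> in \<Omega>. feval M (\<lambda>i. rep (\<rho> i) (tinv t \<omega>)) \<phi>
      = feval M (\<lambda>i. rep (fst (wr_act (g, t)) (\<rho> i)) \<omega>) \<phi>"
    using AE_space
  proof eventually_elim
    case (elim \<omega>)
    then have "g \<omega> \<in> autM M" using g by (simp add: L0G_def)
    from feval_aut[OF this wf] show ?case using elim(1) by simp
  qed
  moreover have R: "(\<lambda>\<omega>. feval M (\<lambda>i. rep (\<rho> i) \<omega>) \<phi>) \<in> L0A"
    using \<rho> by (intro feval_L0A[OF ms wf] measurable aecls_rep(1)) (simp add: MainC_def)
  ultimately show ?thesis
    using snd_wr_act_aecls[OF _ R, of "(g, t)"] t L0A_comp_mp[OF mp_tinv[OF t] R]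
    by (simp add: semR_def aecls_eq_iff aeq_def)
qed

lemma wr_act_connA:
  assumes t: "snd a \<in> autOmega" and c: "conn_ok (length Xs) c" and Xs: "set Xs \<subseteq> AuxC"
  shows "snd (wr_act a) (connA c Xs) = connA c (map (snd (wr_act a)) Xs)"
proof -
  interpret wr_action L0A "\<lambda>_ x. x" "snd a" by (rule wr_action_L0A[OF t])
  have "AE \<omega> in \<Omega>. \<forall>X\<in>set Xs. rep (snd (wr_act a) X) \<omega> = rep X (tinv (snd a) \<omega>)"
    unfolding wr_act_eq_cls_map
    using AE_rep_cls_map_wr_fun Xs by (intro AE_finite_allI) (auto simp: AuxC_def wr_fun_def)
  then have "AE \<omega> in \<Omega>. c (map (\<lambda>X. rep X (tinv (snd a) \<omega>)) Xs)
      = c (map (\<lambda>X. rep X \<omega>) (map (snd (wr_act a)) Xs))"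
    by eventually_elim (simp cong: map_cong)
  moreover have R: "(\<lambda>\<omega>. c (map (\<lambda>X. rep X \<omega>) Xs)) \<in> L0A"
    using conn_L0A[of "map rep Xs" c] c Xs aecls_rep(1)[of _ L0A] by (force simp: comp_def AuxC_def)
  ultimately show ?thesis
    using snd_wr_act_aecls[OF t R] L0A_comp_mp[OF mp_tinv[OF t] R]
    by (simp add: connA_def aecls_eq_iff aeq_def)
qed

lemma wr_act_EA:
  assumes "snd a \<in> autOmega" "X \<in> AuxC"
  shows "EA (snd (wr_act a) X) = EA X"
proof -
  note R = AuxC_rep[OF assms(2)]
  have "EA (snd (wr_act a) X) = (\<integral>\<omega>. rep X (tinv (snd a) \<omega>) \<partial>\<Omega>)"
    using snd_wr_act_aecls[OF assms(1) R(1)] R(2)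
      EA_aecls[OF L0A_comp_mp[OF mp_tinv[OF assms(1)] R(1)]] by simp
  also have "\<dots> = EA X"
    unfolding EA_def by (rule integral_mp[OF mp_tinv[OF assms(1)] Aux.measurable[OF R(1)]])
  finally show ?thesis .
qed

theorem wr_act_in_autMR:
  fixes M :: "('f, 'p, 'm::polish_space) mstruct"
  assumes ms: "metric_structure M" and g: "g \<in> L0G M" and t: "t \<in> autOmega"
  shows "wr_act (g, t) \<in> autMR M"
proof -
  interpret main: wr_action L0M g t by (rule wr_action_L0M[OF ms g t])
  interpret aux: wr_action L0A "\<lambda>_ x. x" t by (rule wr_action_L0A[OF t])
  have "bij_betw (fst (wr_act (g, t))) MainC MainC" "bij_betw (snd (wr_act (g, t))) AuxC AuxC"
    using main.bij_betw_cls_map_wr_fun aux.bij_betw_cls_map_wr_fun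
    by (simp_all add: wr_act_eq_cls_map MainC_def AuxC_def)
  moreover have "dMain (fst (wr_act (g, t)) X) (fst (wr_act (g, t)) Y) = dMain X Y"
    if "X \<in> MainC" "Y \<in> MainC" for X Y
    using main.dMain_cls_map_wr_fun that by (simp add: wr_act_eq_cls_map MainC_def)
  moreover have "dAux (snd (wr_act (g, t)) X) (snd (wr_act (g, t)) Y) = dAux X Y"
    if "X \<in> AuxC" "Y \<in> AuxC" for X Y
    using aux.dMain_cls_map_wr_fun that by (simp add: wr_act_eq_cls_map AuxC_def dAux_eq_dMain)
  moreover note wr_act_semR[OF ms g t] wr_act_connA[of "(g, t)"] wr_act_EA[of "(g, t)"]
  ultimately have "(fst (wr_act (g, t)), snd (wr_act (g, t))) \<in> autMR M"
    using t unfolding autMR_def mem_Collect_eq case_prod_conv snd_conv by blast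
  then show ?thesis by simp
qed

lemma fst_wr_act_const:
  fixes M :: "('f, 'p, 'm::polish_space) mstruct"
  assumes "metric_structure M" "g \<in> L0G M" "t \<in> autOmega"
  shows "fst (wr_act (g, t)) (aecls L0M (\<lambda>_. x)) = aecls L0M (\<lambda>\<omega>. g \<omega> x)"
  using wr_action.cls_map_wr_fun_aecls[OF wr_action_L0M[OF assms], of "\<lambda>_. x"]
  by (simp add: wr_act_eq_cls_map wr_fun_def L0M_def)

theorem wr_act_eq_iff:
  fixes M :: "('f, 'p, 'm::polish_space) mstruct"
  assumes ms: "metric_structure M" and g: "g \<in> L0G M" "g' \<in> L0G M" and t: "t \<in> autOmega" "t' \<in> autOmega"
  shows "autR_eq (wr_act (g, t)) (wr_act (g', t')) \<longleftrightarrow> aeq g g' \<and> aeq t t'"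
proof
  assume eq: "autR_eq (wr_act (g, t)) (wr_act (g', t'))"
  have "aecls L0A (tinv t) = aecls L0A (tinv t')"
    using eq t ident_L0A snd_wr_act_aecls[OF _ ident_L0A, of "(g, t)"]
      snd_wr_act_aecls[OF _ ident_L0A, of "(g', t')"]
    by (auto simp: autR_eq_def AuxC_def)
  then have "aeq t t'"
    using aecls_eq_iff[OF L0A_comp_mp[OF mp_tinv[OF t(1)] ident_L0A]] aeq_tinv_iff[OF t] by simp
  moreover have "aeq g g'"
  proof -
    obtain d :: "nat \<Rightarrow> 'm" where d: "dense_seq d" by (rule dense_seq_exists)
    have "aecls L0M (\<lambda>\<omega>. g \<omega> (d n)) = aecls L0M (\<lambda>\<omega>. g' \<omega> (d n))" for n
      using eq fst_wr_act_const[OF ms g(1) t(1)] fst_wr_act_const[OF ms g(2) t(2)]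
      by (auto simp: autR_eq_def MainC_def L0M_def)
    then have "AE \<omega> in \<Omega>. \<forall>n. g \<omega> (d n) = g' \<omega> (d n)"
      using random_isometriesD(3)[OF L0G_random_isometries[OF g(1)]]
      by (simp add: AE_all_countable aecls_eq_iff L0M_def aeq_def)
    then show ?thesis
      unfolding aeq_def using AE_space
      by eventually_elim (use g[THEN L0G_random_isometries] d in
          \<open>auto intro!: isometries_eqI_dense_seq random_isometriesD(1)\<close>)
  qed
  ultimately show "aeq g g' \<and> aeq t t'" by simp
next
  assume "aeq g g' \<and> aeq t t'"
  then have "aeq (wr_fun (g, t) r) (wr_fun (g', t') r)"
    "aeq (wr_fun (\<lambda>_ x. x, t) R) (wr_fun (\<lambda>_ x. x, t') R)" for r and R :: "real \<Rightarrow> real"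
    using aeq_tinv_iff[OF t] by (auto intro: wr_fun_cong)
  then show "autR_eq (wr_act (g, t)) (wr_act (g', t'))"
    using wr_action.respects_aeq_wr_fun[OF wr_action_L0M[OF ms g(1) t(1)]]
      wr_action.respects_aeq_wr_fun[OF wr_action_L0A[OF t(1)]]
    by (simp add: autR_eq_def wr_act_eq_cls_map cls_map_eq_iff MainC_def AuxC_def)
qed

theorem wr_act_mult:
  fixes M :: "('f, 'p, 'm::polish_space) mstruct"
  assumes ms: "metric_structure M" and g: "g \<in> L0G M" "g' \<in> L0G M" and t: "t \<in> autOmega" "t' \<in> autOmega"
  shows "autR_eq (wr_act (wr_mult (g, t) (g', t'))) (autR_comp (wr_act (g, t)) (wr_act (g', t')))"
  using cls_map_wr_fun_mult[OF wr_action_L0M[OF ms g(1) t(1)] wr_action_L0M[OF ms g(2) t(2)]]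
    cls_map_wr_fun_mult[OF wr_action_L0A[OF t(1)] wr_action_L0A[OF t(2)]]
  by (auto simp: autR_eq_def autR_comp_def wr_act_eq_cls_map MainC_def AuxC_def wr_mult_def comp_def)

subsection \<open>Automorphisms of the auxiliary sort\<close>

definition unit_continuous :: "(real \<Rightarrow> real) \<Rightarrow> bool" where
  "unit_continuous c \<longleftrightarrow> continuous_on UNIV c \<and> (\<forall>x. c x \<in> {0..1})"

lemma unit_continuous_L0A: "unit_continuous c \<Longrightarrow> c \<in> L0A"
  using measurable_compose[OF borel_measurable_id_Omega borel_measurable_continuous_onI, of c]
  by (auto simp: unit_continuous_def L0A_def)

lemma unit_continuous_conn_ok:
  assumes "unit_continuous c"
  shows "conn_ok 1 (\<lambda>xs. c (xs ! 0))"
  unfolding conn_ok_def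
proof (intro conjI allI impI)
  show "c (xs ! 0) \<in> {0..1}" for xs using assms by (auto simp: unit_continuous_def)
  fix e :: real assume "e > 0"
  have "uniformly_continuous_on {0..1} c"
    using assms
    by (intro compact_uniformly_continuous) (auto simp: unit_continuous_def intro: continuous_on_subset)
  then obtain d where d: "d > 0" "\<And>x y. \<lbrakk>x \<in> {0..1}; y \<in> {0..1}; \<bar>x - y\<bar> < d\<rbrakk> \<Longrightarrow> \<bar>c x - c y\<bar> < e"
    using \<open>e > 0\<close> unfolding uniformly_continuous_on_def dist_real_def by metis
  show "\<exists>d>0. \<forall>xs ys. length xs = 1 \<and> length ys = 1 \<and> set xs \<subseteq> {0..1} \<and> set ys \<subseteq> {0..1} \<and>
      (\<forall>i<1. \<bar>xs ! i - ys ! i\<bar> < d) \<longrightarrow> \<bar>c (xs ! 0) - c (ys ! 0)\<bar> < e"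
    using d by (intro exI[of _ d]) (auto simp: length_Suc_conv)
qed

lemma L0A_AE_limit_unit_continuous:
  assumes "R \<in> L0A"
  obtains c where "\<And>n::nat. unit_continuous (c n)" "AE \<omega> in \<Omega>. (\<lambda>n. c n \<omega>) \<longlonglongrightarrow> R \<omega>"
proof -
  define f where "f x = (if x \<in> {0..1} then R x else 0)" for x
  have "f \<in> borel_measurable lborel"
    using Aux.measurable[OF assms] unfolding f_def[abs_def] \<Omega>_def
    by (subst (asm) measurable_restrict_space_iff[where c = 0]) auto
  then have "f measurable_on UNIV"
    by (intro lebesgue_measurable_imp_measurable_on_real measurable_completion) simp_all
  then obtain N g where N: "negligible N" and g: "\<And>n. continuous_on UNIV (g n)"
    and lim: "\<And>x. x \<notin> N \<Longrightarrow> (\<lambda>n. g n x) \<longlonglongrightarrow> f x"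
    unfolding measurable_on_def by auto
  have "AE x in lebesgue. x \<notin> N" using N by (intro AE_not_in) (simp add: negligible_iff_null_sets)
  then have "AE x in lborel. x \<notin> N" by (simp add: AE_completion_iff)
  then have "AE x in \<Omega>. x \<notin> N"
    unfolding \<Omega>_def by (subst AE_restrict_space_iff) auto
  then have "AE x in \<Omega>. (\<lambda>n. max 0 (min 1 (g n x))) \<longlonglongrightarrow> R x"
    using AE_space
  proof eventually_elim
    case (elim x)
    have "max 0 (min 1 (f x)) = R x" using assms elim(2) by (auto simp: L0A_iff f_def)
    moreover have "(\<lambda>n. max 0 (min 1 (g n x))) \<longlonglongrightarrow> max 0 (min 1 (f x))"
      by (intro tendsto_intros lim elim)
    ultimately show ?case by simp
  qed
  moreover have "unit_continuous (\<lambda>x. max 0 (min 1 (g n x)))" for n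
    unfolding unit_continuous_def by (intro conjI continuous_intros g) auto
  ultimately show ?thesis using that[of "\<lambda>n x. max 0 (min 1 (g n x))"] by blast
qed

lemma unit_continuous_dense:
  assumes R: "R \<in> L0A" and "e > 0"
  obtains c where "unit_continuous c" "dMain (aecls L0A R) (aecls L0A c) < e"
proof -
  obtain c where c: "\<And>n::nat. unit_continuous (c n)" and lim: "AE \<omega> in \<Omega>. (\<lambda>n. c n \<omega>) \<longlonglongrightarrow> R \<omega>"
    by (rule L0A_AE_limit_unit_continuous[OF R]) blast
  note cA = unit_continuous_L0A[OF c]
  have "(\<lambda>n. \<integral>\<omega>. dist (R \<omega>) (c n \<omega>) \<partial>\<Omega>) \<longlonglongrightarrow> (\<integral>\<omega>. 0 \<partial>\<Omega>)"
  proof (rule integral_dominated_convergence[where w = "\<lambda>_. 1"])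
    show "AE \<omega> in \<Omega>. (\<lambda>n. dist (R \<omega>) (c n \<omega>)) \<longlonglongrightarrow> 0"
      using lim by eventually_elim (auto intro: tendsto_eq_intros)
    show "(\<lambda>\<omega>. dist (R \<omega>) (c n \<omega>)) \<in> borel_measurable \<Omega>" for n
      by (intro borel_measurable_dist Aux.measurable R cA)
    show "AE \<omega> in \<Omega>. norm (dist (R \<omega>) (c n \<omega>)) \<le> 1" for n
      using Aux.dist_le_1[OF R cA] by (intro AE_I2) simp
  qed simp_all
  then have "(\<lambda>n. dMain (aecls L0A R) (aecls L0A (c n))) \<longlonglongrightarrow> 0"
    by (simp add: Aux.dMain_aecls[OF R cA])
  from order_tendstoD(2)[OF this \<open>e > 0\<close>] show ?thesis
    using c that by (auto simp: eventually_sequentially)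
qed

lemma real_distribution_eqI_cts_step:
  assumes M1: "real_distribution M1" and M2: "real_distribution M2"
    and eq: "\<And>x y. x < y \<Longrightarrow> integral\<^sup>L M1 (cts_step x y) = integral\<^sup>L M2 (cts_step x y)"
  shows "M1 = M2"
proof (rule Levy_uniqueness[OF M1 M2], rule ext)
  fix t
  have "weak_conv_m (\<lambda>_. M1) M2"
    by (rule integral_cts_step_conv_imp_weak_conv) (simp_all add: M1 M2 eq)
  from levy_continuity1[OF M1 M2 this, of t] show "char M1 t = char M2 t"
    by (simp add: LIMSEQ_const_iff)
qed

lemma unit_continuous_cts_step: "x < y \<Longrightarrow> unit_continuous (cts_step x y)"
  using uniformly_continuous_imp_continuous[OF cts_step_uniformly_continuous, of x y]
  by (auto simp: unit_continuous_def cts_step_def divide_simps)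

lemma L0A_measurable_into_Omega: "T \<in> L0A \<Longrightarrow> T \<in> measurable \<Omega> \<Omega>"
  by (rule measurable_into_Omega) (auto simp: L0A_iff)

lemma mp_if_integrals_unit_continuous:
  assumes T: "T \<in> L0A"
    and eq: "\<And>c. unit_continuous c \<Longrightarrow> (\<integral>\<omega>. c (T \<omega>) \<partial>\<Omega>) = (\<integral>\<omega>. c \<omega> \<partial>\<Omega>)"
  shows "mp T"
proof -
  note T_borel = Aux.measurable[OF T] and T_Omega = L0A_measurable_into_Omega[OF T]
  have distr_eq: "distr \<Omega> borel T = distr \<Omega> borel (\<lambda>\<omega>. \<omega>)"
  proof (rule real_distribution_eqI_cts_step)
    show "integral\<^sup>L (distr \<Omega> borel T) (cts_step x y) = integral\<^sup>L (distr \<Omega> borel (\<lambda>\<omega>. \<omega>)) (cts_step x y)"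
      if "x < y" for x y
      using eq[OF unit_continuous_cts_step[OF that]] unit_continuous_cts_step[OF that]
      by (simp add: integral_distr[OF T_borel] integral_distr[OF borel_measurable_id_Omega]
          borel_measurable_continuous_onI unit_continuous_def)
  qed (rule Om.real_distribution_distr T_borel borel_measurable_id_Omega)+
  have "distr \<Omega> \<Omega> T = \<Omega>"
  proof (rule measure_eqI)
    fix A assume "A \<in> sets (distr \<Omega> \<Omega> T)"
    then have A: "A \<in> sets \<Omega>" "A \<in> sets borel" "A \<subseteq> {0..1}" by (auto simp: sets_Omega_iff)
    have "emeasure (distr \<Omega> \<Omega> T) A = emeasure (distr \<Omega> borel T) A"
      using A by (simp add: emeasure_distr[OF T_Omega] emeasure_distr[OF T_borel])
    also have "\<dots> = emeasure \<Omega> (A \<inter> space \<Omega>)"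
      unfolding distr_eq using A by (simp add: emeasure_distr[OF borel_measurable_id_Omega])
    also have "A \<inter> space \<Omega> = A" using A(3) by auto
    finally show "emeasure (distr \<Omega> \<Omega> T) A = emeasure \<Omega> A" .
  qed simp
  then show ?thesis using T_Omega by (simp add: mp_def)
qed

lemma mp_inverses_if_left_inverse:
  assumes T: "mp T" and t: "t \<in> measurable \<Omega> \<Omega>" and left: "AE \<omega> in \<Omega>. t (T \<omega>) = \<omega>"
  shows "mp_inverses t T"
proof -
  note T_Omega = mp_measurable[OF T]
  have "distr \<Omega> \<Omega> t = distr (distr \<Omega> \<Omega> T) \<Omega> t" by (simp add: mp_distr[OF T])
  also have "\<dots> = distr \<Omega> \<Omega> (t \<circ> T)" by (rule distr_distr[OF t T_Omega])
  also have "\<dots> = distr \<Omega> \<Omega> (\<lambda>\<omega>. \<omega>)"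
    by (rule distr_cong_AE) (use left measurable_comp[OF T_Omega t] in auto)
  finally have "mp t" using t by (simp add: mp_def)
  have "T \<in> borel_measurable \<Omega>"
    using measurable_compose[OF T_Omega borel_measurable_id_Omega] .
  then have fixed: "{\<omega> \<in> space \<Omega>. T (t \<omega>) = \<omega>} \<in> sets \<Omega>"
    by (intro borel_measurable_eq measurable_compose[OF t] borel_measurable_id_Omega)
  have "AE \<omega> in \<Omega>. T (t (T \<omega>)) = T \<omega>" using left by eventually_elim simp
  then have "AE \<omega> in distr \<Omega> \<Omega> T. T (t \<omega>) = \<omega>" using AE_distr_iff[OF T_Omega fixed] by simp
  then have "AE \<omega> in \<Omega>. T (t \<omega>) = \<omega>" by (simp only: mp_distr[OF T])
  with \<open>mp t\<close> T left show ?thesis by (simp add: mp_inverses_def)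
qed

locale aux_automorphism =
  fixes \<Psi> :: "(real \<Rightarrow> real) set \<Rightarrow> (real \<Rightarrow> real) set"
  assumes bij: "bij_betw \<Psi> AuxC AuxC"
    and isometric: "X \<in> AuxC \<Longrightarrow> Y \<in> AuxC \<Longrightarrow> dMain (\<Psi> X) (\<Psi> Y) = dMain X Y"
    and EA: "X \<in> AuxC \<Longrightarrow> EA (\<Psi> X) = EA X"
    and connA: "conn_ok (length Xs) c \<Longrightarrow> set Xs \<subseteq> AuxC \<Longrightarrow> \<Psi> (connA c Xs) = connA c (map \<Psi> Xs)"
begin

definition base_map :: "real \<Rightarrow> real" where
  "base_map = rep (\<Psi> (aecls L0A (\<lambda>\<omega>. \<omega>)))"

lemma image_AuxC: "X \<in> AuxC \<Longrightarrow> \<Psi> X \<in> AuxC"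
  using bij by (auto simp: bij_betw_def)

lemma base_map_L0A: "base_map \<in> L0A"
  unfolding base_map_def by (intro AuxC_rep(1) image_AuxC aecls_AuxC ident_L0A)

lemma image_unit_continuous:
  assumes c: "unit_continuous c"
  shows "\<Psi> (aecls L0A c) = aecls L0A (\<lambda>\<omega>. c (base_map \<omega>))"
proof -
  let ?I = "aecls L0A (\<lambda>\<omega>. \<omega>)" and ?c = "\<lambda>xs. c (xs ! 0)"
  have "AE \<omega> in \<Omega>. c \<omega> = c (rep ?I \<omega>)"
    using rep_aecls(2)[OF ident_L0A] unfolding aeq_def by eventually_elim simp
  then have "aecls L0A c = connA ?c [?I]"
    using unit_continuous_L0A[OF c] by (simp add: connA_def aecls_eq_iff aeq_def)
  then show ?thesis
    using connA[of "[?I]" ?c] unit_continuous_conn_ok[OF c] aecls_AuxC[OF ident_L0A]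
    by (simp add: connA_def base_map_def)
qed

lemma mp_base_map: "mp base_map"
proof (rule mp_if_integrals_unit_continuous[OF base_map_L0A])
  fix c assume "unit_continuous c"
  note c = unit_continuous_L0A[OF this]
  have "(\<lambda>\<omega>. c (base_map \<omega>)) \<in> L0A"
    using measurable_compose[OF L0A_measurable_into_Omega[OF base_map_L0A] Aux.measurable[OF c]]
      base_map_L0A c by (simp add: L0A_iff)
  then show "(\<integral>\<omega>. c (base_map \<omega>) \<partial>\<Omega>) = (\<integral>\<omega>. c \<omega> \<partial>\<Omega>)"
    using EA[OF aecls_AuxC[OF c]] by (simp add: image_unit_continuous[OF \<open>unit_continuous c\<close>] EA_aecls c)
qed

lemma image_aecls:
  assumes R: "R \<in> L0A"
  shows "\<Psi> (aecls L0A R) = aecls L0A (\<lambda>\<omega>. R (base_map \<omega>))" (is "?lhs = ?rhs")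
proof -
  note comp = L0A_comp_mp[OF mp_base_map]
  have lhs: "?lhs \<in> AuxC" and rhs: "?rhs \<in> AuxC" using R comp image_AuxC aecls_AuxC by blast+
  have "dMain ?lhs ?rhs \<le> 0 + e" if "e > 0" for e
  proof -
    obtain c where c: "unit_continuous c" and small: "dMain (aecls L0A R) (aecls L0A c) < e / 2"
      using unit_continuous_dense[OF R, of "e / 2"] \<open>e > 0\<close> by auto
    note cA = unit_continuous_L0A[OF c]
    have "dMain ?lhs ?rhs \<le> dMain ?lhs (\<Psi> (aecls L0A c)) + dMain (\<Psi> (aecls L0A c)) ?rhs"
      using Aux.triangle lhs rhs image_AuxC[OF aecls_AuxC[OF cA]] by (simp add: AuxC_def)
    also have "dMain ?lhs (\<Psi> (aecls L0A c)) = dMain (aecls L0A R) (aecls L0A c)"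
      by (intro isometric aecls_AuxC R cA)
    also have "dMain (\<Psi> (aecls L0A c)) ?rhs = (\<integral>\<omega>. dist (c (base_map \<omega>)) (R (base_map \<omega>)) \<partial>\<Omega>)"
      unfolding image_unit_continuous[OF c] by (intro Aux.dMain_aecls comp cA R)
    also have "\<dots> = (\<integral>\<omega>. dist (c \<omega>) (R \<omega>) \<partial>\<Omega>)"
      by (rule integral_mp[OF mp_base_map, where f = "\<lambda>\<omega>. dist (c \<omega>) (R \<omega>)"])
        (intro borel_measurable_dist Aux.measurable cA R)
    also have "\<dots> = dMain (aecls L0A R) (aecls L0A c)"
      by (simp add: Aux.dMain_aecls[OF R cA] dist_commute)
    finally show ?thesis using small by simp
  qed
  then have "dMain ?lhs ?rhs \<le> 0" by (rule field_le_epsilon)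
  then show ?thesis using lhs rhs Aux.mdist_pos_eq[of ?lhs ?rhs] unfolding AuxC_def by fastforce
qed

lemma ex_autOmega: "\<exists>t\<in>autOmega. \<forall>R\<in>L0A. \<Psi> (aecls L0A R) = aecls L0A (\<lambda>\<omega>. R (tinv t \<omega>))"
proof -
  note comp = L0A_comp_mp[OF mp_base_map]
  have "aecls L0A (\<lambda>\<omega>. \<omega>) \<in> \<Psi> ` AuxC" using bij aecls_AuxC[OF ident_L0A] by (simp add: bij_betw_def)
  then obtain t where t: "t \<in> L0A" "\<Psi> (aecls L0A t) = aecls L0A (\<lambda>\<omega>. \<omega>)" by (auto simp: AuxC_def)
  then have "AE \<omega> in \<Omega>. t (base_map \<omega>) = \<omega>"
    using image_aecls[OF t(1)] comp[OF t(1)] by (simp add: aecls_eq_iff aeq_def)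
  then have inv: "mp_inverses t base_map"
    by (rule mp_inverses_if_left_inverse[OF mp_base_map L0A_measurable_into_Omega[OF t(1)]])
  show ?thesis
  proof (intro bexI ballI)
    show "t \<in> autOmega" using inv by (auto simp: autOmega_iff)
    fix R assume R: "R \<in> L0A"
    have "AE \<omega> in \<Omega>. R (base_map \<omega>) = R (tinv t \<omega>)"
      using aeq_tinvI[OF inv] unfolding aeq_def by eventually_elim simp
    then show "\<Psi> (aecls L0A R) = aecls L0A (\<lambda>\<omega>. R (tinv t \<omega>))"
      using comp[OF R] by (simp add: image_aecls[OF R] aecls_eq_iff aeq_def)
  qed
qed

end

lemma autMR_aux_automorphism: "(\<Phi>, \<Psi>) \<in> autMR M \<Longrightarrow> aux_automorphism \<Psi>"
  by (simp add: autMR_def aux_automorphism_def dAux_eq_dMain)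

subsection \<open>Automorphisms of the main sort\<close>

lemma ucont_list_eqI_dense_seq:
  assumes h: "ucont_list n h" and h': "ucont_list n h'" and d: "dense_seq d"
    and eq: "\<And>ks. length ks = n \<Longrightarrow> h (map d ks) = h' (map d ks)" and n: "length xs = n"
  shows "h xs = h' xs"
proof (rule LIMSEQ_unique)
  have lim: "(\<lambda>j. f (map (dense_approx d j) xs)) \<longlonglongrightarrow> f xs" if "ucont_list n f" for f :: "_ \<Rightarrow> 'b"
    using ucont_list_tendsto[where l = "\<lambda>x. x", OF that[folded n] dense_approx_tendsto[OF d]] by simp
  show "(\<lambda>j. h (map (dense_approx d j) xs)) \<longlonglongrightarrow> h xs" by (rule lim[OF h])
  have "h (map (dense_approx d j) xs) = h' (map (dense_approx d j) xs)" for j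
    using eq[of "map (dense_index d (inverse (Suc j))) xs"] n by (simp add: comp_def dense_approx_def[abs_def])
  then show "(\<lambda>j. h (map (dense_approx d j) xs)) \<longlonglongrightarrow> h' xs" using lim[OF h'] by simp
qed

lemma ucont_list_isometry_comp: "ucont_list n h \<Longrightarrow> g \<in> isometries \<Longrightarrow> ucont_list n (\<lambda>xs. g (h xs))"
  by (simp add: ucont_list_def dist_isometry)

lemma ucont_list_map_isometry:
  assumes h: "ucont_list n h" and g: "g \<in> isometries"
  shows "ucont_list n (\<lambda>xs. h (map g xs))"
  unfolding ucont_list_def
proof (intro allI impI)
  fix e :: real assume "e > 0"
  then obtain c where "c > 0" "\<And>xs ys. \<lbrakk>length xs = n; length ys = n; \<forall>i<n. dist (xs ! i) (ys ! i) < c\<rbrakk>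
      \<Longrightarrow> dist (h xs) (h ys) < e"
    using h unfolding ucont_list_def by meson
  then show "\<exists>c>0. \<forall>xs ys. length xs = n \<and> length ys = n \<and> (\<forall>i<n. dist (xs ! i) (ys ! i) < c) \<longrightarrow>
      dist (h (map g xs)) (h (map g ys)) < e"
    by (intro exI[of _ c]) (simp add: dist_isometry[OF g])
qed

lemma isometry_autM_if_dense_seq:
  fixes M :: "('f, 'p, 'm::polish_space) mstruct"
  assumes ms: "metric_structure M" and d: "dense_seq d" and g: "g \<in> isometries"
    and pred: "\<And>p ns. length ns = pred_ar M p \<Longrightarrow> pred_int M p (map g (map d ns)) = pred_int M p (map d ns)"
    and func: "\<And>f ns m. length ns = fun_ar M f \<Longrightarrow>
      dist (fun_int M f (map g (map d ns))) (g (d m)) = dist (fun_int M f (map d ns)) (d m)"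
    and surj: "\<And>n. \<exists>z. \<forall>m. dist (d n) (g (d m)) = dist z (d m)"
  shows "g \<in> autM M"
proof -
  have "surj g"
  proof (rule surj_isometry_if_dense_seq_in_range[OF g d])
    show "range d \<subseteq> range g" using surj isometry_eqI_dist_dense_seq[OF g d] by blast
  qed
  moreover have "g (fun_int M f xs) = fun_int M f (map g xs)" if "length xs = fun_ar M f" for f xs
  proof (rule ucont_list_eqI_dense_seq[OF _ _ d _ that])
    show "g (fun_int M f (map d ns)) = fun_int M f (map g (map d ns))" if "length ns = fun_ar M f" for ns
      by (rule isometry_eqI_dist_dense_seq[OF g d func[OF that], symmetric])
  qed (rule ucont_list_isometry_comp[OF metric_structureD(2)[OF ms] g]
      ucont_list_map_isometry[OF metric_structureD(2)[OF ms] g])+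
  moreover have "pred_int M p (map g xs) = pred_int M p xs" if "length xs = pred_ar M p" for p xs
    by (rule ucont_list_eqI_dense_seq[OF ucont_list_map_isometry[OF metric_structureD(3)[OF ms] g]
          metric_structureD(3)[OF ms] d pred that])
  ultimately show ?thesis
    using g by (simp add: autM_def bij_def inj_isometry dist_isometry)
qed

lemma id_autM: "(\<lambda>x. x) \<in> autM M"
  by (auto simp: autM_def bij_def)

lemma L0G_selection:
  fixes M :: "('f, 'p, 'm::polish_space) mstruct"
  assumes d: "dense_seq d" and h: "\<And>n. h n \<in> borel_measurable \<Omega>"
    and ex: "AE \<omega> in \<Omega>. \<exists>G\<in>autM M. \<forall>n. G (d n) = h n \<omega>"
  obtains g where "g \<in> L0G M" "AE \<omega> in \<Omega>. \<forall>n. g \<omega> (d n) = h n \<omega>"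
proof -
  from ex obtain N where N: "\<And>\<omega>. \<omega> \<in> space \<Omega> - N \<Longrightarrow> \<exists>G\<in>autM M. \<forall>n. G (d n) = h n \<omega>" "N \<in> null_sets \<Omega>"
    by (rule AE_E3) blast
  then obtain G where G: "\<And>\<omega>. \<omega> \<in> space \<Omega> - N \<Longrightarrow> G \<omega> \<in> autM M \<and> (\<forall>n. G \<omega> (d n) = h n \<omega>)"
    by metis
  define g where "g \<omega> = (if \<omega> \<in> N then (\<lambda>x. x) else G \<omega>)" for \<omega>
  have g: "g \<omega> \<in> autM M" if "\<omega> \<in> space \<Omega>" for \<omega>
    using G that by (auto simp: g_def id_autM)
  have "g \<in> borel_measurable \<Omega>"
  proof (rule borel_measurable_isometriesI[OF d autM_isometry[OF g]])
    fix n
    have "(\<lambda>\<omega>. if \<omega> \<in> N then d n else h n \<omega>) \<in> borel_measurable \<Omega>"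
      using null_setsD2[OF N(2)] by (intro measurable_If_set h sets.Int sets.top) simp_all
    then show "(\<lambda>\<omega>. g \<omega> (d n)) \<in> borel_measurable \<Omega>"
      by (rule measurable_cong[THEN iffD1, rotated]) (use G in \<open>auto simp: g_def\<close>)
  qed
  then have "g \<in> L0G M" using g by (simp add: L0G_def)
  moreover have "AE \<omega> in \<Omega>. \<forall>n. g \<omega> (d n) = h n \<omega>"
    using AE_not_in[OF N(2)] AE_space by eventually_elim (use G in \<open>auto simp: g_def\<close>)
  ultimately show ?thesis by (rule that)
qed

locale main_automorphism =
  fixes M :: "('f::countable, 'p::countable, 'm::polish_space) mstruct"
    and \<Phi> :: "(real \<Rightarrow> 'm) set \<Rightarrow> (real \<Rightarrow> 'm) set" and t :: "real \<Rightarrow> real"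
  assumes metric_structure: "metric_structure M" and autOmega: "t \<in> autOmega"
    and bij: "bij_betw \<Phi> MainC MainC"
    and AE_feval_image: "wf_fml M \<phi> \<Longrightarrow> (\<And>i. r i \<in> borel_measurable \<Omega>) \<Longrightarrow>
      AE \<omega> in \<Omega>. feval M (\<lambda>i. rep (\<Phi> (aecls L0M (r i))) \<omega>) \<phi> = feval M (\<lambda>i. r i (tinv t \<omega>)) \<phi>"
begin

definition image_rep :: "(real \<Rightarrow> 'm) \<Rightarrow> real \<Rightarrow> 'm" where
  "image_rep r = rep (\<Phi> (aecls L0M r))"

lemma image_MainC: "X \<in> MainC \<Longrightarrow> \<Phi> X \<in> MainC"
  using bij by (auto simp: bij_betw_def)

lemma borel_measurable_image_rep: "r \<in> borel_measurable \<Omega> \<Longrightarrow> image_rep r \<in> borel_measurable \<Omega>"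
  unfolding image_rep_def by (intro MainC_rep(1) image_MainC aecls_MainC)

lemma AE_dist_image_rep:
  assumes "r \<in> borel_measurable \<Omega>" "s \<in> borel_measurable \<Omega>"
  shows "AE \<omega> in \<Omega>. dist (image_rep r \<omega>) (image_rep s \<omega>) = dist (r (tinv t \<omega>)) (s (tinv t \<omega>))"
  using AE_feval_image[of "Dst (Var 0) (Var 1)" "\<lambda>i. if i = 0 then r else s"] assms
  by (simp add: image_rep_def if_distribR)

lemma AE_pred_image_rep:
  assumes "length xs = pred_ar M p"
  shows "AE \<omega> in \<Omega>. pred_int M p (map (\<lambda>x. image_rep (\<lambda>_. x) \<omega>) xs) = pred_int M p xs"
proof -
  have wf: "wf_fml M (Atom p (map Var [0..<length xs]))" using assms by auto
  have "map (\<lambda>i. q (xs ! i)) [0..<length xs] = map q xs" for q :: "'m \<Rightarrow> 'm"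
    by (rule nth_equalityI) auto
  from this[of "\<lambda>x. image_rep (\<lambda>_. x) _"] this[of "\<lambda>x. x"]
    AE_feval_image[OF wf, of "\<lambda>i _. xs ! i"] show ?thesis
    by (simp add: comp_def image_rep_def del: map_eq_conv)
qed

lemma AE_fun_image_rep:
  assumes "length xs = fun_ar M f"
  shows "AE \<omega> in \<Omega>. dist (fun_int M f (map (\<lambda>x. image_rep (\<lambda>_. x) \<omega>) xs)) (image_rep (\<lambda>_. y) \<omega>)
    = dist (fun_int M f xs) y"
proof -
  let ?l = "length xs" and ?v = "\<lambda>i. if i < length xs then xs ! i else y"
  have wf: "wf_fml M (Dst (Fn f (map Var [0..<?l])) (Var ?l))" using assms by auto
  have "map (\<lambda>i. q (?v i)) [0..<?l] = map q xs" for q :: "'m \<Rightarrow> 'm"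
    by (rule nth_equalityI) auto
  from this[of "\<lambda>x. image_rep (\<lambda>_. x) _"] this[of "\<lambda>x. x"]
    AE_feval_image[OF wf, of "\<lambda>i _. ?v i"] show ?thesis
    by (simp add: comp_def image_rep_def del: map_eq_conv)
qed

lemma AE_dist_image_rep_realized:
  "AE \<omega> in \<Omega>. \<exists>z. \<forall>n. dist x (image_rep (\<lambda>_. d n) \<omega>) = dist z (d n)" for d :: "nat \<Rightarrow> 'm"
proof -
  have const: "(\<lambda>_. y) \<in> borel_measurable \<Omega>" for y :: 'm by simp
  have "aecls L0M (\<lambda>_. x) \<in> \<Phi> ` MainC" using bij by (simp add: bij_betw_def MainC_def L0M_def)
  then obtain r where r: "r \<in> L0M" "\<Phi> (aecls L0M r) = aecls L0M (\<lambda>_. x)"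
    by (auto simp: MainC_def)
  have "AE \<omega> in \<Omega>. image_rep r \<omega> = x"
    using rep_aecls(2)[OF const[folded L0M_def]] unfolding image_rep_def r(2) aeq_def .
  moreover have "AE \<omega> in \<Omega>. \<forall>n. dist (image_rep r \<omega>) (image_rep (\<lambda>_. d n) \<omega>) = dist (r (tinv t \<omega>)) (d n)"
    unfolding AE_all_countable using AE_dist_image_rep[OF r(1)[unfolded L0M_def] const] by blast
  ultimately show ?thesis by eventually_elim auto
qed

lemma AE_ex_autM:
  assumes d: "dense_seq d"
  shows "AE \<omega> in \<Omega>. \<exists>g\<in>autM M. \<forall>n. g (d n) = image_rep (\<lambda>_. d n) \<omega>"
proof -
  let ?h = "\<lambda>n \<omega>. image_rep (\<lambda>_. d n) \<omega>"
  have "AE \<omega> in \<Omega>. \<forall>n m. dist (?h n \<omega>) (?h m \<omega>) = dist (d n) (d m)"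
    unfolding AE_all_countable by (intro allI AE_dist_image_rep) simp_all
  moreover have "AE \<omega> in \<Omega>. \<forall>p ns. length ns = pred_ar M p \<longrightarrow>
      pred_int M p (map (\<lambda>n. ?h n \<omega>) ns) = pred_int M p (map d ns)"
    unfolding AE_all_countable using AE_pred_image_rep[of "map d _"]
    by (auto intro!: AE_impI simp: comp_def)
  moreover have "AE \<omega> in \<Omega>. \<forall>f ns m. length ns = fun_ar M f \<longrightarrow>
      dist (fun_int M f (map (\<lambda>n. ?h n \<omega>) ns)) (?h m \<omega>) = dist (fun_int M f (map d ns)) (d m)"
    unfolding AE_all_countable using AE_fun_image_rep[of "map d _"]
    by (auto intro!: AE_impI simp: comp_def)
  moreover have "AE \<omega> in \<Omega>. \<forall>n. \<exists>z. \<forall>m. dist (d n) (?h m \<omega>) = dist z (d m)"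
    unfolding AE_all_countable by (intro allI AE_dist_image_rep_realized)
  ultimately show ?thesis
  proof eventually_elim
    case (elim \<omega>)
    obtain g where g: "g \<in> isometries" "\<And>n. g (d n) = ?h n \<omega>"
      using isometry_extension_dense_seq[OF d, of "\<lambda>n. ?h n \<omega>"] elim(1) by blast
    have "g \<in> autM M"
      by (rule isometry_autM_if_dense_seq[OF metric_structure d g(1)])
        (use elim(2-4) in \<open>simp_all add: g(2) comp_def\<close>)
    then show ?case using g(2) by blast
  qed
qed

lemma ex_L0G: "\<exists>g\<in>L0G M. \<forall>X\<in>MainC. \<Phi> X = fst (wr_act (g, t)) X"
proof -
  obtain d :: "nat \<Rightarrow> 'm" where d: "dense_seq d" by (rule dense_seq_exists)
  have const: "(\<lambda>_. x) \<in> borel_measurable \<Omega>" for x :: 'm by simp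
  obtain g where g: "g \<in> L0G M" and gd: "AE \<omega> in \<Omega>. \<forall>n. g \<omega> (d n) = image_rep (\<lambda>_. d n) \<omega>"
    by (rule L0G_selection[OF d borel_measurable_image_rep[OF const] AE_ex_autM[OF d]])
  show ?thesis
  proof (rule bexI[OF _ g], rule ballI)
    fix X :: "(real \<Rightarrow> 'm) set" assume X: "X \<in> MainC"
    have "AE \<omega> in \<Omega>. \<forall>n. dist (rep (\<Phi> X) \<omega>) (image_rep (\<lambda>_. d n) \<omega>) = dist (rep X (tinv t \<omega>)) (d n)"
      unfolding AE_all_countable
      using AE_dist_image_rep[OF MainC_rep(1)[OF X] const] by (simp add: image_rep_def MainC_rep(2)[OF X])
    then have "AE \<omega> in \<Omega>. rep (\<Phi> X) \<omega> = g \<omega> (rep X (tinv t \<omega>))"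
      using gd AE_space
    proof eventually_elim
      case (elim \<omega>)
      have "g \<omega> \<in> isometries" using random_isometriesD(1)[OF L0G_random_isometries[OF g]] elim(3) by simp
      then show ?case by (rule isometry_eqI_dist_dense_seq[OF _ d]) (use elim(1,2) in simp)
    qed
    then have "aecls L0M (rep (\<Phi> X)) = fst (wr_act (g, t)) X"
      using MainC_rep(1)[OF image_MainC[OF X]] by (simp add: wr_act_def aecls_eq_iff L0M_def aeq_def)
    then show "\<Phi> X = fst (wr_act (g, t)) X" using MainC_rep(2)[OF image_MainC[OF X]] by simp
  qed
qed

end

lemma autMR_main_automorphism:
  fixes M :: "('f::countable, 'p::countable, 'm::polish_space) mstruct"
  assumes ms: "metric_structure M" and aut: "(\<Phi>, \<Psi>) \<in> autMR M" and t: "t \<in> autOmega"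
    and \<Psi>: "\<And>R. R \<in> L0A \<Longrightarrow> \<Psi> (aecls L0A R) = aecls L0A (\<lambda>\<omega>. R (tinv t \<omega>))"
  shows "main_automorphism M \<Phi> t"
proof
  show "bij_betw \<Phi> MainC MainC" using aut by (simp add: autMR_def)
  fix \<phi> :: "('f, 'p) fml" and r :: "nat \<Rightarrow> real \<Rightarrow> 'm"
  assume wf: "wf_fml M \<phi>" and r: "\<And>i. r i \<in> borel_measurable \<Omega>"
  define \<rho> where "\<rho> i = aecls L0M (r i)" for i
  have \<rho>: "\<rho> i \<in> MainC" for i using r by (simp add: \<rho>_def MainC_def L0M_def)
  note feval_aux = feval_L0A[OF ms wf, of r, OF r]
  have "AE \<omega> in \<Omega>. \<forall>i. rep (\<rho> i) \<omega> = r i \<omega>"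
    unfolding AE_all_countable \<rho>_def using rep_aecls(2)[of "r _" L0M] r by (auto simp: L0M_def aeq_def)
  then have "AE \<omega> in \<Omega>. feval M (\<lambda>i. r i \<omega>) \<phi> = feval M (\<lambda>i. rep (\<rho> i) \<omega>) \<phi>"
    by eventually_elim simp
  then have "semR M \<phi> \<rho> = aecls L0A (\<lambda>\<omega>. feval M (\<lambda>i. r i \<omega>) \<phi>)"
    unfolding semR_def using aecls_eq_iff[OF feval_aux, of "\<lambda>\<omega>. feval M (\<lambda>i. rep (\<rho> i) \<omega>) \<phi>"] by (simp add: aeq_def)
  moreover have "\<Psi> (semR M \<phi> \<rho>) = semR M \<phi> (\<Phi> \<circ> \<rho>)" using aut wf \<rho> by (simp add: autMR_def)
  ultimately have "aecls L0A (\<lambda>\<omega>. feval M (\<lambda>i. r i (tinv t \<omega>)) \<phi>) = semR M \<phi> (\<Phi> \<circ> \<rho>)"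
    using \<Psi>[OF feval_aux] by simp
  then have "AE \<omega> in \<Omega>. feval M (\<lambda>i. r i (tinv t \<omega>)) \<phi> = feval M (\<lambda>i. rep (\<Phi> (\<rho> i)) \<omega>) \<phi>"
    unfolding semR_def using aecls_eq_iff[OF L0A_comp_mp[OF mp_tinv[OF t] feval_aux]] by (simp add: aeq_def)
  then show "AE \<omega> in \<Omega>. feval M (\<lambda>i. rep (\<Phi> (aecls L0M (r i))) \<omega>) \<phi> = feval M (\<lambda>i. r i (tinv t \<omega>)) \<phi>"
    unfolding \<rho>_def by eventually_elim simp
qed (fact ms t)+

theorem autMR_eq_wr_act:
  fixes M :: "('f::countable, 'p::countable, 'm::polish_space) mstruct"
  assumes ms: "metric_structure M" and a: "a \<in> autMR M"
  shows "\<exists>g\<in>L0G M. \<exists>t\<in>autOmega. autR_eq a (wr_act (g, t))"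
proof -
  obtain \<Phi> \<Psi> where a_eq: "a = (\<Phi>, \<Psi>)" by (rule prod.exhaust)
  with a have aut: "(\<Phi>, \<Psi>) \<in> autMR M" by simp
  obtain t where t: "t \<in> autOmega" and \<Psi>: "\<And>R. R \<in> L0A \<Longrightarrow> \<Psi> (aecls L0A R) = aecls L0A (\<lambda>\<omega>. R (tinv t \<omega>))"
    using aux_automorphism.ex_autOmega[OF autMR_aux_automorphism[OF aut]] by blast
  obtain g where g: "g \<in> L0G M" "\<forall>X\<in>MainC. \<Phi> X = fst (wr_act (g, t)) X"
    using main_automorphism.ex_L0G[OF autMR_main_automorphism[OF ms aut t \<Psi>]] by blast
  have "\<Psi> X = snd (wr_act (g, t)) X" if "X \<in> AuxC" for X
    using that snd_wr_act_aecls[of "(g, t)"] t \<Psi> by (auto simp: AuxC_def)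
  with g t show ?thesis by (auto simp: autR_eq_def a_eq)
qed

subsection \<open>Topologies\<close>

lemma sets_sym_diff_vimage:
  assumes "mp t" "mp u" "A \<in> sets \<Omega>"
  shows "sym_diff (u -` A \<inter> space \<Omega>) (t -` A \<inter> space \<Omega>) \<in> sets \<Omega>"
  using measurable_sets[OF mp_measurable] assms by (intro sets.Un sets.Diff) auto

lemma measure_sym_diff_vimage_inverses:
  assumes t: "mp_inverses t s" and u: "mp_inverses u v" and A: "A \<in> sets \<Omega>"
  defines "B \<equiv> s -` A \<inter> space \<Omega>"
  shows "measure \<Omega> (sym_diff (v -` A \<inter> space \<Omega>) (s -` A \<inter> space \<Omega>))
    = measure \<Omega> (sym_diff (u -` B \<inter> space \<Omega>) (t -` B \<inter> space \<Omega>))"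
proof -
  note T = mp_inversesD[OF t] and U = mp_inversesD[OF u]
  let ?E = "sym_diff (v -` A \<inter> space \<Omega>) (s -` A \<inter> space \<Omega>)"
  have B: "B \<in> sets \<Omega>" unfolding B_def by (rule measurable_sets[OF mp_measurable[OF T(2)] A])
  have E: "?E \<in> sets \<Omega>" by (rule sets_sym_diff_vimage[OF T(2) U(2) A])
  have "measure \<Omega> ?E = measure \<Omega> (u -` ?E \<inter> space \<Omega>)" by (rule measure_mp_vimage[OF U(1) E, symmetric])
  also have "\<dots> = measure \<Omega> (sym_diff (u -` B \<inter> space \<Omega>) (t -` B \<inter> space \<Omega>))"
  proof (rule Om.finite_measure_eq_AE)
    show "AE \<omega> in \<Omega>. (\<omega> \<in> u -` ?E \<inter> space \<Omega>) = (\<omega> \<in> sym_diff (u -` B \<inter> space \<Omega>) (t -` B \<inter> space \<Omega>))"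
      using T(3) U(3) AE_space
    proof eventually_elim
      case (elim \<omega>)
      then show ?case
        using measurable_space[OF mp_measurable[OF T(1)]] measurable_space[OF mp_measurable[OF U(1)]]
        by (auto simp: B_def)
    qed
  qed (rule measurable_sets[OF mp_measurable[OF U(1)] E] sets_sym_diff_vimage[OF T(1) U(1) B])+
  finally show ?thesis .
qed

lemma convOmega_inverses:
  assumes ts: "\<And>i. mp_inverses (ts i) (ss i)" and t: "mp_inverses t s" and conv: "convOmega F ts t"
  shows "convOmega F ss s"
  unfolding convOmega_def
proof
  fix A assume A: "A \<in> sets \<Omega>"
  then have "s -` A \<inter> space \<Omega> \<in> sets \<Omega>" by (rule measurable_sets[OF mp_measurable[OF mp_inversesD(2)[OF t]]])
  with conv show "((\<lambda>i. measure \<Omega> (sym_diff (ss i -` A \<inter> space \<Omega>) (s -` A \<inter> space \<Omega>))) \<longlongrightarrow> 0) F"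
    unfolding convOmega_def measure_sym_diff_vimage_inverses[OF t ts A] by blast
qed

lemma convOmega_tinv_iff:
  assumes "\<And>i. ts i \<in> autOmega" "t \<in> autOmega"
  shows "convOmega F (\<lambda>i. tinv (ts i)) (tinv t) \<longleftrightarrow> convOmega F ts t"
proof -
  note inv = mp_inverses_tinv[OF assms(1)] mp_inverses_tinv[OF assms(2)]
  show ?thesis
    using convOmega_inverses[of ts "\<lambda>i. tinv (ts i)" t "tinv t" F, OF inv]
      convOmega_inverses[of "\<lambda>i. tinv (ts i)" ts "tinv t" t F, OF inv[THEN mp_inverses_sym]] by blast
qed

lemma convOmega_imp_tendsto_0_in_measure:
  fixes r :: "real \<Rightarrow> 'a::{metric_space, second_countable_topology}"
  assumes conv: "convOmega F ts t" and ts: "\<And>i. mp (ts i)" and t: "mp t" and r: "r \<in> borel_measurable \<Omega>"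
  shows "tendsto_0_in_measure \<Omega> F (\<lambda>i \<omega>. dist (r (ts i \<omega>)) (r (t \<omega>)))"
  unfolding tendsto_0_in_measure_def
proof (intro allI impI)
  fix e :: real assume "e > 0"
  obtain d :: "nat \<Rightarrow> 'a" where d: "dense_seq d" by (rule dense_seq_exists)
  define K where "K \<omega> = dense_index d (e / 2) (r \<omega>)" for \<omega>
  have K [measurable]: "K \<in> measurable \<Omega> (count_space UNIV)"
    unfolding K_def[abs_def] by (intro measurable_dense_index borel_measurable_dist r) simp
  have close: "dist (d (K \<omega>)) (r \<omega>) < e / 2" for \<omega>
    unfolding K_def using \<open>e > 0\<close> by (intro dist_dense_index[OF d]) simp
  define A where "A k = {\<omega> \<in> space \<Omega>. K \<omega> = k}" for k
  have A: "A k \<in> sets \<Omega>" for k unfolding A_def by measurable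
  let ?D = "\<lambda>k i. sym_diff (ts i -` A k \<inter> space \<Omega>) (t -` A k \<inter> space \<Omega>)"
  show "((\<lambda>i. measure \<Omega> {\<omega> \<in> space \<Omega>. e < dist (r (ts i \<omega>)) (r (t \<omega>))}) \<longlongrightarrow> 0) F"
  proof (rule Om.measure_tendsto_0_if_covered[where K = "\<lambda>\<omega>. K (t \<omega>)" and D = ?D])
    show "(\<lambda>\<omega>. K (t \<omega>)) \<in> measurable \<Omega> (count_space UNIV)"
      by (rule measurable_compose[OF mp_measurable[OF t] K])
    show "?D k i \<in> sets \<Omega>" for k i by (rule sets_sym_diff_vimage[OF t ts A])
    show "((\<lambda>i. measure \<Omega> (?D k i)) \<longlongrightarrow> 0) F" for k using conv A by (simp only: convOmega_def)
    have "\<omega> \<in> ?D (K (t \<omega>)) i" if \<omega>: "\<omega> \<in> space \<Omega>" "e < dist (r (ts i \<omega>)) (r (t \<omega>))" for i \<omega>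
    proof -
      have "K (ts i \<omega>) \<noteq> K (t \<omega>)"
      proof
        assume eq: "K (ts i \<omega>) = K (t \<omega>)"
        have "dist (r (ts i \<omega>)) (r (t \<omega>)) \<le> dist (d (K (ts i \<omega>))) (r (ts i \<omega>)) + dist (d (K (t \<omega>))) (r (t \<omega>))"
          unfolding eq by (rule dist_triangle3)
        with close[of "ts i \<omega>"] close[of "t \<omega>"] \<omega>(2) show False by simp
      qed
      then show ?thesis
        using \<omega>(1) measurable_space[OF mp_measurable[OF t] \<omega>(1)] by (simp add: A_def)
    qed
    then show "{\<omega> \<in> space \<Omega>. e < dist (r (ts i \<omega>)) (r (t \<omega>))} \<subseteq> {\<omega> \<in> space \<Omega>. \<omega> \<in> ?D (K (t \<omega>)) i}" for i
      by blast
  qed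
qed

lemma convOmega_if_tendsto_0_in_measure_indicator:
  assumes "\<And>A. A \<in> sets \<Omega> \<Longrightarrow>
      tendsto_0_in_measure \<Omega> F (\<lambda>i \<omega>. dist (indicator A (ts i \<omega>) :: real) (indicator A (t \<omega>)))"
  shows "convOmega F ts t"
  unfolding convOmega_def
proof
  fix A assume "A \<in> sets \<Omega>"
  from tendsto_0_in_measureD[OF assms[OF this], of "1 / 2"]
  have "((\<lambda>i. measure \<Omega> {\<omega> \<in> space \<Omega>. 1 / 2 < dist (indicator A (ts i \<omega>) :: real) (indicator A (t \<omega>))})
      \<longlongrightarrow> 0) F"
    by simp
  moreover have "{\<omega> \<in> space \<Omega>. 1 / 2 < dist (indicator A (ts i \<omega>) :: real) (indicator A (t \<omega>))}
      = sym_diff (ts i -` A \<inter> space \<Omega>) (t -` A \<inter> space \<Omega>)" for i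
    by (auto simp: indicator_def dist_real_def split: if_splits)
  ultimately show "((\<lambda>i. measure \<Omega> (sym_diff (ts i -` A \<inter> space \<Omega>) (t -` A \<inter> space \<Omega>))) \<longlongrightarrow> 0) F"
    by simp
qed

lemma random_isometries_tendsto_0_in_measure:
  fixes g :: "real \<Rightarrow> 'a::polish_space \<Rightarrow> 'a"
  assumes gs: "\<And>i. gs i \<in> random_isometries" and g: "g \<in> random_isometries" and d: "dense_seq d"
    and conv: "\<And>n. tendsto_0_in_measure \<Omega> F (\<lambda>i \<omega>. dist (gs i \<omega> (d n)) (g \<omega> (d n)))"
    and q: "q \<in> borel_measurable \<Omega>"
  shows "tendsto_0_in_measure \<Omega> F (\<lambda>i \<omega>. dist (gs i \<omega> (q \<omega>)) (g \<omega> (q \<omega>)))"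
  unfolding tendsto_0_in_measure_def
proof (intro allI impI)
  fix e :: real assume "e > 0"
  define K where "K \<omega> = dense_index d (e / 3) (q \<omega>)" for \<omega>
  have close: "dist (d (K \<omega>)) (q \<omega>) < e / 3" for \<omega>
    unfolding K_def using \<open>e > 0\<close> by (intro dist_dense_index[OF d]) simp
  have [measurable]: "(\<lambda>\<omega>. dist (gs i \<omega> (d k)) (g \<omega> (d k))) \<in> borel_measurable \<Omega>" for i k
    by (intro borel_measurable_dist random_isometriesD(3) gs g)
  let ?D = "\<lambda>k i. {\<omega> \<in> space \<Omega>. e / 3 < dist (gs i \<omega> (d k)) (g \<omega> (d k))}"
  show "((\<lambda>i. measure \<Omega> {\<omega> \<in> space \<Omega>. e < dist (gs i \<omega> (q \<omega>)) (g \<omega> (q \<omega>))}) \<longlongrightarrow> 0) F"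
  proof (rule Om.measure_tendsto_0_if_covered[where K = K and D = ?D])
    show "K \<in> measurable \<Omega> (count_space UNIV)"
      unfolding K_def[abs_def] by (intro measurable_dense_index borel_measurable_dist q) simp
    show "?D k i \<in> sets \<Omega>" for k i by measurable
    show "((\<lambda>i. measure \<Omega> (?D k i)) \<longlongrightarrow> 0) F" for k
      using \<open>e > 0\<close> by (intro tendsto_0_in_measureD[OF conv]) simp
    have "e / 3 < dist (gs i \<omega> (d (K \<omega>))) (g \<omega> (d (K \<omega>)))"
      if "\<omega> \<in> space \<Omega>" "e < dist (gs i \<omega> (q \<omega>)) (g \<omega> (q \<omega>))" for i \<omega>
    proof -
      let ?x = "d (K \<omega>)"
      have "dist (gs i \<omega> (q \<omega>)) (g \<omega> (q \<omega>))
          \<le> dist (gs i \<omega> (q \<omega>)) (gs i \<omega> ?x) + dist (gs i \<omega> ?x) (g \<omega> ?x) + dist (g \<omega> ?x) (g \<omega> (q \<omega>))"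
        by (smt (verit) dist_triangle)
      also have "\<dots> < e / 3 + dist (gs i \<omega> ?x) (g \<omega> ?x) + e / 3"
        using that(1) close[of \<omega>] by (simp add: dist_isometry[OF random_isometriesD(1)[OF gs]]
            dist_isometry[OF random_isometriesD(1)[OF g]] dist_commute)
      finally show ?thesis using that(2) by simp
    qed
    then show "{\<omega> \<in> space \<Omega>. e < dist (gs i \<omega> (q \<omega>)) (g \<omega> (q \<omega>))} \<subseteq> {\<omega> \<in> space \<Omega>. \<omega> \<in> ?D (K \<omega>) i}" for i
      by blast
  qed
qed

lemma sets_L0G_vimage_openin:
  assumes "g \<in> L0G M" "openin (top_of_set (autM M)) U"
  shows "{\<omega> \<in> space \<Omega>. g \<omega> \<in> U} \<in> sets \<Omega>"
proof -
  obtain V where V: "open V" "U = autM M \<inter> V" using assms(2) by (auto simp: openin_open)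
  then have "{\<omega> \<in> space \<Omega>. g \<omega> \<in> U} = g -` V \<inter> space \<Omega>" using assms(1) by (auto simp: L0G_def)
  also have "\<dots> \<in> sets \<Omega>" using assms(1) V(1) by (intro measurable_sets[of g \<Omega> borel]) (auto simp: L0G_def)
  finally show ?thesis .
qed

lemma convG_iff_dense_seq:
  fixes M :: "('f, 'p, 'm::polish_space) mstruct"
  assumes gs: "\<And>i. gs i \<in> L0G M" and g: "g \<in> L0G M" and d: "dense_seq d"
  shows "convG M F gs g \<longleftrightarrow> (\<forall>n. tendsto_0_in_measure \<Omega> F (\<lambda>i \<omega>. dist (gs i \<omega> (d n)) (g \<omega> (d n))))"
proof -
  have convG: "convG M F gs g \<longleftrightarrow> (\<forall>\<rho>. compatible_metric (autM M) \<rho> \<longrightarrow>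
      tendsto_0_in_measure \<Omega> F (\<lambda>i \<omega>. \<rho> (gs i \<omega>) (g \<omega>)))"
    by (simp add: convG_def tendsto_0_in_measure_def)
  have comp: "compatible_metric (autM M) (seq_dist d)"
    by (rule compatible_metric_seq_dist[OF _ d]) (auto simp: autM_isometry)
  note meas = random_isometriesD(3)[OF L0G_random_isometries[OF gs]]
    random_isometriesD(3)[OF L0G_random_isometries[OF g]]
  have "convG M F gs g \<longleftrightarrow> tendsto_0_in_measure \<Omega> F (\<lambda>i \<omega>. seq_dist d (gs i \<omega>) (g \<omega>))"
    unfolding convG
  proof (intro iffI allI impI)
    fix \<rho> assume conv: "tendsto_0_in_measure \<Omega> F (\<lambda>i \<omega>. seq_dist d (gs i \<omega>) (g \<omega>))"
      and \<rho>: "compatible_metric (autM M) \<rho>"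
    show "tendsto_0_in_measure \<Omega> F (\<lambda>i \<omega>. \<rho> (gs i \<omega>) (g \<omega>))"
    proof (rule Om.tendsto_0_in_measure_change_metric[where S = "autM M" and f = gs and g = g
          and \<rho> = "seq_dist d", OF conv])
      show "{\<omega> \<in> space \<Omega>. g \<omega> \<in> U} \<in> sets \<Omega>"
        if "openin (Metric_space.mtopology (autM M) (seq_dist d)) U" for U
        using that comp by (intro sets_L0G_vimage_openin[OF g]) (simp add: compatible_metric_def)
      show "(\<lambda>\<omega>. seq_dist d (gs i \<omega>) (g \<omega>)) \<in> borel_measurable \<Omega>" for i
        unfolding seq_dist_def comp_def
        by (intro borel_measurable_dist measurable_coordinatewise_then_product meas)
    qed (use comp \<rho> gs g in \<open>auto simp: compatible_metric_def L0G_def\<close>)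
  qed (use comp in blast)
  also have "\<dots> \<longleftrightarrow> (\<forall>n. tendsto_0_in_measure \<Omega> F (\<lambda>i \<omega>. dist (gs i \<omega> (d n)) (g \<omega> (d n))))"
    unfolding seq_dist_def
    using Om.tendsto_0_in_measure_coordinate[of F "\<lambda>i \<omega>. gs i \<omega> \<circ> d" "\<lambda>\<omega>. g \<omega> \<circ> d"]
      Om.tendsto_0_in_measure_coordinatewise[of F "\<lambda>i \<omega>. gs i \<omega> \<circ> d" "\<lambda>\<omega>. g \<omega> \<circ> d"] meas by auto
  finally show ?thesis .
qed

lemma wr_fun_tendsto_0_in_measure:
  fixes g :: "real \<Rightarrow> 'a::polish_space \<Rightarrow> 'a"
  assumes gs: "\<And>i. gs i \<in> random_isometries" and g: "g \<in> random_isometries"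
    and ts: "\<And>i. ts i \<in> autOmega" and t: "t \<in> autOmega" and conv: "convOmega F ts t" and d: "dense_seq d"
    and pointwise: "\<And>n. tendsto_0_in_measure \<Omega> F (\<lambda>i \<omega>. dist (gs i \<omega> (d n)) (g \<omega> (d n)))"
    and r: "r \<in> borel_measurable \<Omega>"
  shows "tendsto_0_in_measure \<Omega> F (\<lambda>i \<omega>. dist (wr_fun (gs i, ts i) r \<omega>) (wr_fun (g, t) r \<omega>))"
proof -
  let ?q = "\<lambda>t \<omega>. r (tinv t \<omega>)"
  have q: "?q u \<in> borel_measurable \<Omega>" if "u \<in> autOmega" for u
    by (rule borel_measurable_comp_mp[OF mp_tinv[OF that] r])
  have apply_q: "(\<lambda>\<omega>. h \<omega> (?q t \<omega>)) \<in> borel_measurable \<Omega>" if "h \<in> random_isometries" for h :: "real \<Rightarrow> 'a \<Rightarrow> 'a"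
    using borel_measurable_wr_fun[OF that t r] by (simp add: wr_fun_def)
  have "tendsto_0_in_measure \<Omega> F (\<lambda>i \<omega>. dist (?q (ts i) \<omega>) (?q t \<omega>))"
    using conv
    by (intro convOmega_imp_tendsto_0_in_measure mp_tinv ts t r) (simp add: convOmega_tinv_iff ts t)
  moreover have "tendsto_0_in_measure \<Omega> F (\<lambda>i \<omega>. dist (gs i \<omega> (?q t \<omega>)) (g \<omega> (?q t \<omega>)))"
    by (rule random_isometries_tendsto_0_in_measure[OF gs g d pointwise q[OF t]])
  ultimately have "tendsto_0_in_measure \<Omega> F
      (\<lambda>i \<omega>. dist (?q (ts i) \<omega>) (?q t \<omega>) + dist (gs i \<omega> (?q t \<omega>)) (g \<omega> (?q t \<omega>)))"
    by (intro Om.tendsto_0_in_measure_add borel_measurable_dist q apply_q ts t gs g)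
  then show ?thesis
  proof (rule Om.tendsto_0_in_measure_mono)
    show "(\<lambda>\<omega>. dist (?q (ts i) \<omega>) (?q t \<omega>) + dist (gs i \<omega> (?q t \<omega>)) (g \<omega> (?q t \<omega>)))
        \<in> borel_measurable \<Omega>" for i
      by (intro borel_measurable_add borel_measurable_dist q apply_q ts t gs g)
    fix i \<omega> assume "\<omega> \<in> space \<Omega>"
    then have "dist (gs i \<omega> (?q (ts i) \<omega>)) (gs i \<omega> (?q t \<omega>)) = dist (?q (ts i) \<omega>) (?q t \<omega>)"
      using gs by (simp add: dist_isometry random_isometriesD(1))
    then show "dist (wr_fun (gs i, ts i) r \<omega>) (wr_fun (g, t) r \<omega>)
        \<le> dist (?q (ts i) \<omega>) (?q t \<omega>) + dist (gs i \<omega> (?q t \<omega>)) (g \<omega> (?q t \<omega>))"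
      using dist_triangle[of "gs i \<omega> (?q (ts i) \<omega>)" "g \<omega> (?q t \<omega>)" "gs i \<omega> (?q t \<omega>)"]
      by (simp add: wr_fun_def)
  qed
qed

lemma autR_conv_wr_act_iff:
  fixes M :: "('f, 'p, 'm::polish_space) mstruct"
  assumes ms: "metric_structure M" and gs: "\<And>i. gs i \<in> L0G M" and g: "g \<in> L0G M"
    and ts: "\<And>i. ts i \<in> autOmega" and t: "t \<in> autOmega"
  shows "autR_conv F (\<lambda>i. wr_act (gs i, ts i)) (wr_act (g, t)) \<longleftrightarrow>
    (\<forall>r\<in>L0M. tendsto_0_in_measure \<Omega> F (\<lambda>i \<omega>. dist (wr_fun (gs i, ts i) r \<omega>) (wr_fun (g, t) r \<omega>))) \<and>
    (\<forall>R\<in>L0A. tendsto_0_in_measure \<Omega> F (\<lambda>i \<omega>. dist (R (tinv (ts i) \<omega>)) (R (tinv t \<omega>))))"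
proof -
  have main: "wr_action L0M (gs i) (ts i)" "wr_action L0M g t"
    and aux: "wr_action L0A (\<lambda>_ x. x) (ts i)" "wr_action L0A (\<lambda>_ x. x) t" for i
    by (rule wr_action_L0M[OF ms gs ts] wr_action_L0M[OF ms g t] wr_action_L0A[OF ts] wr_action_L0A[OF t])+
  interpret Main: bounded_L0 "L0M :: (real \<Rightarrow> 'm) set" by (rule bounded_L0_L0M[OF ms])
  show ?thesis
    using main[THEN wr_action.wr_fun_closed] aux[THEN wr_action.wr_fun_closed]
    by (simp add: autR_conv_def MainC_def AuxC_def wr_act_eq_cls_map dAux_eq_dMain
        main[THEN wr_action.cls_map_wr_fun_aecls] aux[THEN wr_action.cls_map_wr_fun_aecls]
        Main.dMain_aecls_tendsto_0_iff Aux.dMain_aecls_tendsto_0_iff)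
      (simp add: wr_fun_def)
qed

lemma indicator_L0A: "A \<in> sets \<Omega> \<Longrightarrow> indicator A \<in> L0A"
  by (simp add: L0A_iff indicator_def)

theorem wr_conv_iff_autR_conv:
  fixes M :: "('f, 'p, 'm::polish_space) mstruct"
  assumes ms: "metric_structure M" and gs: "\<And>i. gs i \<in> L0G M" and g: "g \<in> L0G M"
    and ts: "\<And>i. ts i \<in> autOmega" and t: "t \<in> autOmega"
  shows "wr_conv M F (\<lambda>i. (gs i, ts i)) (g, t) \<longleftrightarrow> autR_conv F (\<lambda>i. wr_act (gs i, ts i)) (wr_act (g, t))"
proof -
  obtain d :: "nat \<Rightarrow> 'm" where d: "dense_seq d" by (rule dense_seq_exists)
  have "wr_conv M F (\<lambda>i. (gs i, ts i)) (g, t) \<longleftrightarrow> convG M F gs g \<and> convOmega F ts t" by (simp add: wr_conv_def)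
  also have "\<dots> \<longleftrightarrow>
      (\<forall>r\<in>L0M. tendsto_0_in_measure \<Omega> F (\<lambda>i \<omega>. dist (wr_fun (gs i, ts i) r \<omega>) (wr_fun (g, t) r \<omega>))) \<and>
      (\<forall>R\<in>L0A. tendsto_0_in_measure \<Omega> F (\<lambda>i \<omega>. dist (R (tinv (ts i) \<omega>)) (R (tinv t \<omega>))))"
    (is "_ \<longleftrightarrow> ?main \<and> ?aux")
  proof (intro iffI conjI)
    assume "convG M F gs g \<and> convOmega F ts t"
    then have conv: "convG M F gs g" "convOmega F ts t" by simp_all
    then show ?main
      by (auto simp: convG_iff_dense_seq[OF gs g d] L0M_def intro!: wr_fun_tendsto_0_in_measure
          intro: L0G_random_isometries gs g ts t d)
    have "convOmega F (\<lambda>i. tinv (ts i)) (tinv t)" using conv(2) by (simp add: convOmega_tinv_iff ts t)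
    from convOmega_imp_tendsto_0_in_measure[OF this mp_tinv[OF ts] mp_tinv[OF t]] show ?aux
      using Aux.measurable by blast
  next
    assume "?main \<and> ?aux"
    then have main: ?main and aux: ?aux by simp_all
    show "convG M F gs g"
      unfolding convG_iff_dense_seq[OF gs g d]
      using main[rule_format, of "\<lambda>_. d _"] by (simp add: wr_fun_def L0M_def)
    have "convOmega F (\<lambda>i. tinv (ts i)) (tinv t)"
      by (rule convOmega_if_tendsto_0_in_measure_indicator) (use aux indicator_L0A in blast)
    then show "convOmega F ts t" by (simp add: convOmega_tinv_iff ts t)
  qed
  also have "\<dots> \<longleftrightarrow> autR_conv F (\<lambda>i. wr_act (gs i, ts i)) (wr_act (g, t))"
    by (rule autR_conv_wr_act_iff[OF ms gs g ts t, symmetric])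
  finally show ?thesis .
qed

theorem mainTheorem9:
  fixes M :: "('f::countable, 'p::countable, 'm::polish_space) mstruct"
    and F :: "'i filter"
  assumes "metric_structure M"
    and "\<exists>x y::'m. x \<noteq> y"
  shows
    "(\<forall>g\<in>L0G M. \<forall>t\<in>autOmega. wr_act (g, t) \<in> autMR M)
   \<and> (\<forall>g\<in>L0G M. \<forall>t\<in>autOmega. \<forall>g'\<in>L0G M. \<forall>t'\<in>autOmega.
        autR_eq (wr_act (g, t)) (wr_act (g', t')) \<longleftrightarrow> aeq g g' \<and> aeq t t')
   \<and> (\<forall>a\<in>autMR M. \<exists>g\<in>L0G M. \<exists>t\<in>autOmega. autR_eq a (wr_act (g, t)))
   \<and> (\<forall>g\<in>L0G M. \<forall>t\<in>autOmega. \<forall>g'\<in>L0G M. \<forall>t'\<in>autOmega.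
        autR_eq (wr_act (wr_mult (g, t) (g', t'))) (autR_comp (wr_act (g, t)) (wr_act (g', t'))))
   \<and> (\<forall>as a. (\<forall>i. fst (as i) \<in> L0G M \<and> snd (as i) \<in> autOmega) \<and> fst a \<in> L0G M \<and> snd a \<in> autOmega \<longrightarrow>
        (wr_conv M F as a \<longleftrightarrow> autR_conv F (\<lambda>i. wr_act (as i)) (wr_act a)))"
proof (intro conjI)
  note ms = assms(1)
  show "\<forall>g\<in>L0G M. \<forall>t\<in>autOmega. wr_act (g, t) \<in> autMR M"
    using wr_act_in_autMR[OF ms] by blast
  show "\<forall>g\<in>L0G M. \<forall>t\<in>autOmega. \<forall>g'\<in>L0G M. \<forall>t'\<in>autOmega.
      autR_eq (wr_act (g, t)) (wr_act (g', t')) \<longleftrightarrow> aeq g g' \<and> aeq t t'"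
    using wr_act_eq_iff[OF ms] by blast
  show "\<forall>a\<in>autMR M. \<exists>g\<in>L0G M. \<exists>t\<in>autOmega. autR_eq a (wr_act (g, t))"
    using autMR_eq_wr_act[OF ms] by blast
  show "\<forall>g\<in>L0G M. \<forall>t\<in>autOmega. \<forall>g'\<in>L0G M. \<forall>t'\<in>autOmega.
      autR_eq (wr_act (wr_mult (g, t) (g', t'))) (autR_comp (wr_act (g, t)) (wr_act (g', t')))"
    using wr_act_mult[OF ms] by blast
  show "\<forall>as a. (\<forall>i. fst (as i) \<in> L0G M \<and> snd (as i) \<in> autOmega) \<and> fst a \<in> L0G M \<and> snd a \<in> autOmega \<longrightarrow>
      (wr_conv M F as a \<longleftrightarrow> autR_conv F (\<lambda>i. wr_act (as i)) (wr_act a))"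
  proof (intro allI impI)
    fix as :: "'i \<Rightarrow> (real \<Rightarrow> 'm \<Rightarrow> 'm) \<times> (real \<Rightarrow> real)" and a :: "(real \<Rightarrow> 'm \<Rightarrow> 'm) \<times> (real \<Rightarrow> real)"
    assume "(\<forall>i. fst (as i) \<in> L0G M \<and> snd (as i) \<in> autOmega) \<and> fst a \<in> L0G M \<and> snd a \<in> autOmega"
    then show "wr_conv M F as a \<longleftrightarrow> autR_conv F (\<lambda>i. wr_act (as i)) (wr_act a)"
      using wr_conv_iff_autR_conv[OF ms, of "\<lambda>i. fst (as i)" "fst a" "\<lambda>i. snd (as i)" "snd a" F] by simp
  qed
qed

end
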